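(* Let $0<\lambda\le1\le\Lambda$, let $\omega$ be as in the context, let $\Omega\subset\mathbb H^n$ be open, and let $\eta=2\sqrt{\Lambda/\lambda}+1$. There exist constants $C\ge1$ and $K\ge\eta$ depending only on $\lambda,\Lambda,Q$, and a constant $\epsilon_0>0$ depending only on $\lambda,\Lambda,Q,\omega$, such that for every symplectic $A\in M_n(\lambda,\Lambda,\Omega)\cap C(\Omega,\omega)$ and every $u\in C^2(\Omega)$ satisfying $u\ge0$ and $\mathcal L_Au=0$ in $B_{Kr}(z_0)\subset\Omega$ for some $z_0\in\Omega$ and some $0<r\le\frac{\eta}{K}\epsilon_0$, one has $$\sup_{B_r(z_0)}u\le C\inf_{B_r(z_0)}u.$$
   Context: Points $z=(x,t)\in\mathbb R^{2n+1}$; $J=\begin{pmatrix}0&-\mathbb I_n\\ \mathbb I_n&0\end{pmatrix}$, $Q=2n+2$. $\mathbb H^n$: $(x,t)\circ(\xi,\tau)=(x+\xi,t+\tau+2\langle Jx,\xi\rangle)$, $(x,t)^{-1}=(-x,-t)$; $\rho(x,t)=(|x|^4+t^2)^{1/4}$, $d(z,\zeta)=\rho(z^{-1}\circ\zeta)$, $B_R(z)=\{\zeta:d(z,\zeta)<R\}$. $X_i=\partial_{x_i}+2(Jx)_i\partial_t$, $D^2_{\mathbb H}u=(\tfrac12(X_iX_j+X_jX_i)u)_{i,j=1}^{2n}$, $\mathcal L_Au(z)=\mathrm{tr}(A(z)D^2_{\mathbb H}u(z))=\sum a_{ij}(z)X_iX_ju(z)$. $M_n(\lambda,\Lambda,\Omega)$: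 symmetric matrix functions on $\Omega$ with $\det A(z)=1$ and $\lambda\mathbb I\le A(z)\le\Lambda\mathbb I$; symplectic means $A(z)^{-1}=J^tA(z)J$ for all $z$. $\omega:[0,1)\to[0,1)$ nondecreasing with $\omega(0)=\lim_{s\to0^+}\omega(s)=0$; $C(\Omega,\omega)$: continuous $A$ with $\sup_{z\in B_\epsilon(z_0)\cap\Omega}\|A(z)-A(z_0)\|\le\omega(\epsilon)$ for all $z_0\in\Omega$, $0<\epsilon<1$ ($\|\cdot\|$ operator norm). *)

theory Defs
  imports "HOL-Analysis.Analysis"
begin

text \<open>Points of the Heisenberg group H^n are z = (x,t) with x in R^{2n}, t in R.
  The 2n horizontal coordinates are indexed by the type 'n + 'n, where n = CARD('n):
  Inl k is coordinate k (1 <= k <= n), Inr k is coordinate n+k.\<close>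

type_synonym 'n hpt = "(real^('n + 'n)) \<times> real"

definition Jmat :: "real^('n::finite + 'n)^('n + 'n)" where
  "Jmat = (\<chi> i j. (case (i, j) of
      (Inl a, Inr b) \<Rightarrow> (if a = b then -1 else 0)
    | (Inr a, Inl b) \<Rightarrow> (if a = b then 1 else 0)
    | _ \<Rightarrow> 0))"

definition hmult :: "'n::finite hpt \<Rightarrow> 'n hpt \<Rightarrow> 'n hpt" where
  "hmult z w = (fst z + fst w, snd z + snd w + 2 * ((Jmat *v fst z) \<bullet> fst w))"

definition hinv :: "'n::finite hpt \<Rightarrow> 'n hpt" where
  "hinv z = (- fst z, - snd z)"

definition hgauge :: "'n::finite hpt \<Rightarrow> real" where
  "hgauge z = ((norm (fst z)) ^ 4 + (snd z)^2) powr (1/4)"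

definition hdist :: "'n::finite hpt \<Rightarrow> 'n hpt \<Rightarrow> real" where
  "hdist z w = hgauge (hmult (hinv z) w)"

definition hball :: "'n::finite hpt \<Rightarrow> real \<Rightarrow> 'n hpt set" where
  "hball z R = {w. hdist z w < R}"

definition Xdir :: "('n::finite + 'n) \<Rightarrow> 'n hpt \<Rightarrow> 'n hpt" where
  "Xdir i z = (axis i 1, 2 * (Jmat *v fst z) $ i)"

definition Xf :: "('n::finite + 'n) \<Rightarrow> ('n hpt \<Rightarrow> real) \<Rightarrow> 'n hpt \<Rightarrow> real" where
  "Xf i u z = frechet_derivative u (at z) (Xdir i z)"

definition hhess :: "('n::finite hpt \<Rightarrow> real) \<Rightarrow> 'n hpt \<Rightarrow> real^('n + 'n)^('n + 'n)" where
  "hhess u z = (\<chi> i j. (Xf i (Xf j u) z + Xf j (Xf i u) z) / 2)"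

definition LA :: "('n::finite hpt \<Rightarrow> real^('n + 'n)^('n + 'n)) \<Rightarrow> ('n hpt \<Rightarrow> real) \<Rightarrow> 'n hpt \<Rightarrow> real" where
  "LA A u z = trace (A z ** hhess u z)"

definition C2_on :: "'a::euclidean_space set \<Rightarrow> ('a \<Rightarrow> real) \<Rightarrow> bool" where
  "C2_on S u \<longleftrightarrow>
     (\<forall>z\<in>S. u differentiable (at z)) \<and>
     (\<forall>v. \<forall>z\<in>S. (\<lambda>y. frechet_derivative u (at y) v) differentiable (at z)) \<and>
     (\<forall>v w. continuous_on S (\<lambda>z. frechet_derivative (\<lambda>y. frechet_derivative u (at y) v) (at z) w))"

definition Mclass :: "real \<Rightarrow> real \<Rightarrow> 'n::finite hpt set \<Rightarrow> ('n hpt \<Rightarrow> real^('n + 'n)^('n + 'n)) \<Rightarrow> bool" where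
  "Mclass l L S A \<longleftrightarrow> (\<forall>z\<in>S. transpose (A z) = A z \<and> det (A z) = 1 \<and>
      (\<forall>\<xi>. l * (\<xi> \<bullet> \<xi>) \<le> \<xi> \<bullet> (A z *v \<xi>) \<and> \<xi> \<bullet> (A z *v \<xi>) \<le> L * (\<xi> \<bullet> \<xi>)))"

definition symplectic_on :: "'n::finite hpt set \<Rightarrow> ('n hpt \<Rightarrow> real^('n + 'n)^('n + 'n)) \<Rightarrow> bool" where
  "symplectic_on S A \<longleftrightarrow> (\<forall>z\<in>S. matrix_inv (A z) = transpose Jmat ** A z ** Jmat)"

definition modulus :: "(real \<Rightarrow> real) \<Rightarrow> bool" where
  "modulus \<omega> \<longleftrightarrow> (\<forall>s\<in>{0..<1}. \<omega> s \<in> {0..<1}) \<and> mono_on {0..<1} \<omega> \<and> \<omega> 0 = 0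
     \<and> (\<omega> \<longlongrightarrow> 0) (at_right 0)"

text \<open>C(Omega,omega) (the sup bound is stated pointwise, which is what sup <= omega means); operator norm of a matrix is onorm of the associated linear map.\<close>
definition Cclass :: "'n::finite hpt set \<Rightarrow> (real \<Rightarrow> real) \<Rightarrow> ('n hpt \<Rightarrow> real^('n + 'n)^('n + 'n)) \<Rightarrow> bool" where
  "Cclass S \<omega> A \<longleftrightarrow> continuous_on S A \<and>
     (\<forall>z0\<in>S. \<forall>\<epsilon>. 0 < \<epsilon> \<and> \<epsilon> < 1 \<longrightarrow>
        (\<forall>z\<in>hball z0 \<epsilon> \<inter> S. onorm (\<lambda>v. (A z - A z0) *v v) \<le> \<omega> \<epsilon>))"

end

theory Submission
  imports Defs
begin

text \<open>Freeze the coefficients at a point \<open>\<zeta>\<close> and put \<open>P = A(\<zeta>)\<^sup>-\<^sup>1\<close>, \<open>\<zeta>\<^sup>-\<^sup>1 z = (y, t)\<close>. Since \<open>A\<close> is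
  symplectic, \<open>\<langle>P y, y\<rangle>\<^sup>2 + t\<^sup>2\<close> to the power \<open>(2 - Q)/4\<close> is, up to a constant, the fundamental solution of
  the frozen operator. With the power \<open>(1 - Q)/4\<close> instead it is a subsolution, and all terms produced
  by the operator carry the common factor \<open>\<langle>P y, y\<rangle>\<close>, so that it stays a subsolution of any operator
  whose coefficients are close to \<open>A(\<zeta>)\<close>. As the barrier is of order \<open>d\<^sup>1\<^sup>-\<^sup>Q\<close>, its sums over lattice
  points of mesh \<open>h\<close> are bounded at distance \<open>h\<close> from the lattice like a convergent integral.
  Comparison with such a sum gives a growth lemma that is linear in the density of lattice points
  near which a nonnegative solution is at least \<open>T\<close>; counting lattice points replaces measure
  theory and no covering argument is needed. The Harnack inequality follows by applying the growth
  lemma twice at a maximum point of \<open>u(z) (2r - d(z\<^sub>0, z))\<^sup>Q\<close>: to \<open>(1 + \<theta>) M - u\<close> on a small ball, which shows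
  that \<open>u \<ge> M/2\<close> at half of the lattice points, and then to \<open>u\<close> on the ball of radius \<open>2r\<close>.\<close>

subsection \<open>The Heisenberg metric\<close>

lemma sum_UNIV_Plus:
  "(\<Sum>i\<in>UNIV. f i) = (\<Sum>a\<in>UNIV. f (Inl a)) + (\<Sum>b\<in>UNIV. f (Inr b))"
  for f :: "'a::finite + 'b::finite \<Rightarrow> 'c::comm_monoid_add"
  using sum.Plus[of "UNIV :: 'a set" "UNIV :: 'b set" f] by (simp add: UNIV_Plus_UNIV)

lemma Jmat_Inl [simp]: "(Jmat *v x) $ Inl a = - x $ Inr a"
  and Jmat_Inr [simp]: "(Jmat *v x) $ Inr a = x $ Inl a"
  for x :: "real^('n::finite + 'n)"
  by (simp_all add: matrix_vector_mult_def Jmat_def sum_UNIV_Plus if_distrib[of "\<lambda>c. c * _"]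
      sum.delta cong: if_cong)

lemma inner_sum_index:
  fixes x y :: "real^('n::finite + 'n)"
  shows "x \<bullet> y = (\<Sum>a\<in>UNIV. x $ Inl a * y $ Inl a) + (\<Sum>a\<in>UNIV. x $ Inr a * y $ Inr a)"
  by (simp add: inner_vec_def sum_UNIV_Plus)

lemma Jmat_inner: "(Jmat *v x) \<bullet> y = - (x \<bullet> (Jmat *v y))"
  for x y :: "real^('n::finite + 'n)"
  by (simp add: inner_sum_index sum_negf)

lemma Jmat_inner_self [simp]: "(Jmat *v x) \<bullet> x = 0" "x \<bullet> (Jmat *v x) = 0"
  for x :: "real^('n::finite + 'n)"
  using Jmat_inner[of x x] by (simp_all add: inner_commute)

lemma Jmat_Jmat [simp]: "Jmat *v (Jmat *v x) = - x"
  for x :: "real^('n::finite + 'n)"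
proof (subst vec_eq_iff, intro allI)
  fix i show "(Jmat *v (Jmat *v x)) $ i = (- x) $ i" by (cases i) auto
qed

lemma Jmat_uminus [simp]: "Jmat *v (- x) = - (Jmat *v x)"
  for x :: "real^('n::finite + 'n)"
  using matrix_vector_mult_diff_distrib[of Jmat 0 x] by simp

lemma Jmat_inner_Jmat [simp]: "(Jmat *v x) \<bullet> (Jmat *v y) = x \<bullet> y"
  for x y :: "real^('n::finite + 'n)"
  by (simp add: Jmat_inner)

lemma norm_Jmat [simp]: "norm (Jmat *v x) = norm x"
  for x :: "real^('n::finite + 'n)"
  by (simp add: norm_eq_sqrt_inner)

lemma transpose_Jmat_inner: "x \<bullet> (transpose Jmat *v y) = (Jmat *v x) \<bullet> y"
  for x y :: "real^('n::finite + 'n)"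
  by (metis dot_lmul_matrix vector_transpose_matrix)

text \<open>Since x and Jx are orthogonal and equally long, this is Bessel's inequality for y. The
  vector \<open>v\<close> is |x|^2 times the projection of y to the span of x and Jx; Cauchy-Schwarz
  for \<open>v\<close> and y gives the bound multiplied by \<open>a^2 + b^2\<close>, which is then
  cancelled.\<close>

lemma Jmat_bessel: "(x \<bullet> y)^2 + ((Jmat *v x) \<bullet> y)^2 \<le> (norm x)^2 * (norm y)^2"
  for x y :: "real^('n::finite + 'n)"
proof -
  define a b where "a = x \<bullet> y" and "b = (Jmat *v x) \<bullet> y"
  define v where "v = a *\<^sub>R x + b *\<^sub>R (Jmat *v x)"
  have nv: "v \<bullet> v = (a^2 + b^2) * (norm x)^2"
    unfolding v_def unfolding power2_norm_eq_inner
    by (simp add: inner_add algebra_simps power2_eq_square)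
  have vy: "v \<bullet> y = a^2 + b^2"
    unfolding v_def by (simp add: inner_add a_def b_def power2_eq_square)
  have "(v \<bullet> y)^2 \<le> (v \<bullet> v) * (y \<bullet> y)" by (rule Cauchy_Schwarz_ineq)
  then have le: "(a^2+b^2)^2 \<le> (a^2+b^2) * ((norm x)^2 * (norm y)^2)"
    by (simp add: nv vy power2_norm_eq_inner ac_simps)
  show ?thesis
  proof (cases "a^2 + b^2 = 0")
    case True then show ?thesis by (simp add: a_def b_def)
  next
    case False
    then have "a^2+b^2 > 0" by (simp add: sum_power2_gt_zero_iff)
    with le have "a^2 + b^2 \<le> (norm x)^2 * (norm y)^2"
      unfolding power2_eq_square[of "a^2+b^2"] by (rule mult_left_le_imp_le)
    then show ?thesis by (simp add: a_def b_def)
  qed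
qed

section \<open>The gauge distance\<close>

definition hrel :: "'n::finite hpt \<Rightarrow> 'n hpt \<Rightarrow> real" where
  "hrel z w = snd w - snd z - 2 * ((Jmat *v fst z) \<bullet> fst w)"

text \<open>Here \<open>hrel z w\<close> is the vertical component of z^(-1) o w. It is
  antisymmetric because J is skew, which makes the distance symmetric.\<close>

lemma hdist_alt: "hdist z w = (norm (fst w - fst z) ^ 4 + (hrel z w)\<^sup>2) powr (1/4)"
  unfolding hdist_def hgauge_def hmult_def hinv_def hrel_def
  by (simp add: algebra_simps)

lemma hdist_nonneg [simp]: "0 \<le> hdist z w"
  by (simp add: hdist_alt)

lemma hdist_pow4: "hdist z w ^ 4 = norm (fst w - fst z) ^ 4 + (hrel z w)\<^sup>2"
proof -
  have "hdist z w ^ 4 = hdist z w powr 4"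
    using powr_realpow'[of "hdist z w" 4] by simp
  then show ?thesis by (simp add: hdist_alt powr_powr)
qed

lemma hdist_commute: "hdist z w = hdist w z"
proof -
  have "hrel z w = - hrel w z"
    unfolding hrel_def using Jmat_inner[of "fst z" "fst w"] by (simp add: inner_commute)
  then show ?thesis by (simp add: hdist_alt norm_minus_commute)
qed

lemma hdist_self [simp]: "hdist z z = 0"
  by (simp add: hdist_alt hrel_def)

lemma hdist_sq: "(hdist z w)\<^sup>2 = cmod (Complex ((norm (fst w - fst z))\<^sup>2) (hrel z w))"
proof -
  have "((hdist z w)\<^sup>2)\<^sup>2 = (cmod (Complex ((norm (fst w - fst z))\<^sup>2) (hrel z w)))\<^sup>2"
    using hdist_pow4[of z w] by (simp add: cmod_power2)
  then show ?thesis by (rule power2_eq_imp_eq) auto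
qed

lemma norm_fst_le_hdist: "norm (fst b - fst a) \<le> hdist a b"
proof -
  have "norm (fst b - fst a) ^ 4 \<le> hdist a b ^ 4" by (simp add: hdist_pow4)
  then show ?thesis by (rule power_le_imp_le_base[of _ 3, simplified]) auto
qed

text \<open>Cygan's argument: \<open>d\<^sup>2\<close> is the modulus of \<open>|x|\<^sup>2 + i t\<close>, and the group law adds to the sum of two
  such numbers only a cross term of modulus at most \<open>|x| |y|\<close>.\<close>
lemma hdist_triangle: "hdist z w \<le> hdist z v + hdist v w"
proof -
  define x y where "x = fst v - fst z" and "y = fst w - fst v"
  have fw: "fst w - fst z = x + y" by (simp add: x_def y_def)
  have rel: "hrel z w = hrel z v + hrel v w + 2 * ((Jmat *v x) \<bullet> y)"
    unfolding hrel_def x_def y_def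
    by (simp add: matrix_vector_mult_diff_distrib inner_diff)
  have nx: "(norm (x+y))\<^sup>2 = (norm x)\<^sup>2 + (norm y)\<^sup>2 + 2 * (x \<bullet> y)"
    by (simp add: power2_norm_eq_inner inner_add inner_commute)
  have split: "Complex ((norm (fst w - fst z))\<^sup>2) (hrel z w)
     = Complex ((norm x)\<^sup>2) (hrel z v) + Complex ((norm y)\<^sup>2) (hrel v w)
       + 2 * Complex (x \<bullet> y) ((Jmat *v x) \<bullet> y)"
    unfolding fw rel nx by (simp add: complex_eq_iff)
  have "cmod (Complex (x \<bullet> y) ((Jmat *v x) \<bullet> y)) \<le> norm x * norm y"
    using Jmat_bessel[of x y] by (simp add: cmod_def real_sqrt_le_iff flip: power_mult_distrib)
       (metis abs_of_nonneg mult_nonneg_nonneg norm_ge_zero real_sqrt_abs real_sqrt_le_iff)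
  moreover have "norm x * norm y \<le> hdist z v * hdist v w"
    unfolding x_def y_def by (intro mult_mono norm_fst_le_hdist) auto
  moreover have "cmod (Complex ((norm (fst w - fst z))\<^sup>2) (hrel z w)) \<le>
     cmod (Complex ((norm x)\<^sup>2) (hrel z v)) + cmod (Complex ((norm y)\<^sup>2) (hrel v w))
      + 2 * cmod (Complex (x \<bullet> y) ((Jmat *v x) \<bullet> y))"
    unfolding split by (intro order_trans[OF norm_triangle_ineq] add_mono norm_triangle_ineq)
       (simp add: norm_mult)
  ultimately have "(hdist z w)\<^sup>2 \<le> (hdist z v + hdist v w)\<^sup>2"
    unfolding hdist_sq[of z w] using hdist_sq[of z v] hdist_sq[of v w]
    unfolding x_def y_def by (simp add: power2_sum)
  then show ?thesis by (rule power2_le_imp_le) simp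
qed

lemma hrel_le_hdist: "\<bar>hrel a b\<bar> \<le> (hdist a b)\<^sup>2"
  unfolding hdist_sq using abs_Im_le_cmod[of "Complex _ (hrel a b)"] by simp

lemma hdist_lessI:
  assumes "norm (fst w - fst z) ^ 4 + (hrel z w)\<^sup>2 < R ^ 4" "0 \<le> R"
  shows "hdist z w < R"
  using assms unfolding hdist_pow4[symmetric] by (rule power_less_imp_less_base)

lemma continuous_on_hrel [continuous_intros]: "continuous_on S (hrel z)"
  unfolding hrel_def by (intro continuous_intros)

text \<open>Continuity at the zero of the distance comes for free once the fourth root is written as
  the square root of a modulus.\<close>

lemma continuous_on_hdist [continuous_intros]: "continuous_on S (hdist z)"
proof -
  have "continuous_on S (\<lambda>w. sqrt (cmod (Complex ((norm (fst w - fst z))\<^sup>2) (hrel z w))))"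
    unfolding Complex_eq by (intro continuous_intros)
  then show ?thesis
    by (simp flip: hdist_sq)
qed

lemma open_hball_set: "open {w. hdist z w < R}" "open {w. R < hdist z w}"
  by (intro open_Collect_less continuous_intros)+

lemma closed_hcball: "closed {w. hdist z w \<le> R}" "closed {w. R \<le> hdist z w}"
  by (intro closed_Collect_le continuous_intros)+

text \<open>As <Jx, x> = 0, the twist of the group law is 2 <Jx, x' - x> and is controlled by the
  distance too. So gauge balls are bounded in the Euclidean sense, with a constant that depends on
  the centre.\<close>

lemma norm_snd_le_hdist: "\<bar>snd w - snd z\<bar> \<le> (hdist z w)\<^sup>2 + 2 * norm (fst z) * hdist z w"
proof -
  have "snd w - snd z = hrel z w + 2 * ((Jmat *v fst z) \<bullet> (fst w - fst z))"
    unfolding hrel_def by (simp add: inner_diff)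
  moreover have "\<bar>(Jmat *v fst z) \<bullet> (fst w - fst z)\<bar> \<le> norm (fst z) * norm (fst w - fst z)"
    using Cauchy_Schwarz_ineq2[of "Jmat *v fst z"] by simp
  moreover have "norm (fst z) * norm (fst w - fst z) \<le> norm (fst z) * hdist z w"
    by (intro mult_left_mono norm_fst_le_hdist) auto
  ultimately show ?thesis using hrel_le_hdist[of z w] by linarith
qed

lemma compact_hcball: "compact {w. hdist z w \<le> R}"
proof -
  have "bounded {w. hdist z w \<le> R}"
    unfolding bounded_any_center[of _ z]
  proof (intro exI ballI)
    fix w assume "w \<in> {w. hdist z w \<le> R}"
    then have w: "hdist z w \<le> R" by simp
    have R: "0 \<le> R" using order_trans[OF hdist_nonneg w] .
    have mono: "2 * norm (fst z) * hdist z w \<le> 2 * norm (fst z) * R"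
      using w by (intro mult_left_mono) auto
    have "dist z w \<le> dist (fst z) (fst w) + dist (snd z) (snd w)"
      unfolding dist_prod_def by (simp add: sqrt_sum_squares_le_sum)
    also have "\<dots> \<le> R + (R\<^sup>2 + 2 * norm (fst z) * R)"
      using norm_fst_le_hdist[of w z] norm_snd_le_hdist[of w z] w
        power_mono[OF w hdist_nonneg, of 2] mono
      unfolding dist_norm real_norm_def norm_minus_commute[of "fst z"] abs_minus_commute[of "snd z"]
      by linarith
    finally show "dist z w \<le> R + (R\<^sup>2 + 2 * norm (fst z) * R)" .
  qed
  then show ?thesis using closed_hcball(1) by (simp add: compact_eq_bounded_closed)
qed

subsection \<open>Second derivatives along horizontal lines\<close>

text \<open>The left-invariant field with components \<open>a\<close> in the frame
  \<open>Xdir\<close>, evaluated at \<open>z\<close>; see \<open>hdir_eq_sum\<close>.\<close>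

definition hdir :: "'n::finite hpt \<Rightarrow> real^('n + 'n) \<Rightarrow> 'n hpt" where
  "hdir z a = (a, 2 * ((Jmat *v fst z) \<bullet> a))"

text \<open>\<open>D\<close> is the second derivative of \<open>f\<close> at \<open>z\<close> along \<open>z \<circ> (s a, 0)\<close>, which is a straight line.\<close>
definition line2 :: "('n::finite hpt \<Rightarrow> real) \<Rightarrow> 'n hpt \<Rightarrow> real^('n + 'n) \<Rightarrow> real \<Rightarrow> bool" where
  "line2 f z a D \<longleftrightarrow> (\<exists>g. (\<forall>\<^sub>F s in nhds 0. ((\<lambda>s. f (z + s *\<^sub>R hdir z a)) has_real_derivative g s) (at s))
      \<and> (g has_real_derivative D) (at 0))"

lemma line2_add:
  assumes "line2 f z a D" "line2 g z a E"
  shows "line2 (\<lambda>z. f z + g z) z a (D + E)"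
proof -
  obtain f' g' where f': "\<forall>\<^sub>F s in nhds 0. ((\<lambda>s. f (z + s *\<^sub>R hdir z a)) has_real_derivative f' s) (at s)"
      "(f' has_real_derivative D) (at 0)"
    and g': "\<forall>\<^sub>F s in nhds 0. ((\<lambda>s. g (z + s *\<^sub>R hdir z a)) has_real_derivative g' s) (at s)"
      "(g' has_real_derivative E) (at 0)"
    using assms unfolding line2_def by blast
  have "\<forall>\<^sub>F s in nhds 0. ((\<lambda>s. f (z + s *\<^sub>R hdir z a) + g (z + s *\<^sub>R hdir z a)) has_real_derivative f' s + g' s) (at s)"
    using f'(1) g'(1) by eventually_elim (rule DERIV_add)
  then show ?thesis unfolding line2_def using DERIV_add[OF f'(2) g'(2)] by (intro exI conjI)
qed

lemma line2_cmult:
  assumes "line2 f z a D"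
  shows "line2 (\<lambda>z. c * f z) z a (c * D)"
proof -
  obtain f' where f': "\<forall>\<^sub>F s in nhds 0. ((\<lambda>s. f (z + s *\<^sub>R hdir z a)) has_real_derivative f' s) (at s)"
      "(f' has_real_derivative D) (at 0)"
    using assms unfolding line2_def by blast
  have "\<forall>\<^sub>F s in nhds 0. ((\<lambda>s. c * f (z + s *\<^sub>R hdir z a)) has_real_derivative c * f' s) (at s)"
    using f'(1) by eventually_elim (rule DERIV_cmult)
  then show ?thesis unfolding line2_def using DERIV_cmult[OF f'(2), of c] by (intro exI conjI)
qed

lemma line2_const: "line2 (\<lambda>z. c) z a 0"
  unfolding line2_def by (intro exI[of _ "\<lambda>s. 0"]) auto

lemma line2_diff:
  assumes "line2 f z a D" "line2 g z a E"
  shows "line2 (\<lambda>z. f z - g z) z a (D - E)"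
  using line2_add[OF assms(1) line2_cmult[OF assms(2), of "-1"]] by simp

lemma line2_sum:
  assumes "finite S" "\<And>i. i \<in> S \<Longrightarrow> line2 (f i) z a (D i)"
  shows "line2 (\<lambda>z. \<Sum>i\<in>S. f i z) z a (\<Sum>i\<in>S. D i)"
  using assms by (induction S rule: finite_induct) (auto intro: line2_const line2_add)

text \<open>The first derivative vanishes at 0. If \<open>D\<close> were positive, it would be
  positive just to the right of 0, and the mean value theorem would give a value above the
  maximum.\<close>

lemma second_derivative_local_max:
  fixes h :: "real \<Rightarrow> real"
  assumes h: "\<forall>\<^sub>F s in nhds 0. (h has_real_derivative g s) (at s)"
    and g: "(g has_real_derivative D) (at 0)"
    and max: "\<forall>\<^sub>F s in nhds 0. h s \<le> h 0"
  shows "D \<le> 0"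
proof (rule ccontr)
  assume "\<not> D \<le> 0"
  then have D: "0 < D" by simp
  obtain e1 where e1: "0 < e1" "\<And>s. \<bar>s\<bar> < e1 \<Longrightarrow> (h has_real_derivative g s) (at s)"
    using h unfolding eventually_nhds_metric by (auto simp: dist_real_def)
  obtain e2 where e2: "0 < e2" "\<And>s. \<bar>s\<bar> < e2 \<Longrightarrow> h s \<le> h 0"
    using max unfolding eventually_nhds_metric by (auto simp: dist_real_def)
  have "g 0 = 0"
    using DERIV_local_max[OF e1(2)[of 0] e2(1)] e1(1) e2(2) by auto
  moreover obtain e3 where e3: "0 < e3" "\<And>s. 0 < s \<Longrightarrow> s < e3 \<Longrightarrow> g 0 < g s"
    using DERIV_pos_inc_right[OF g D] by auto
  ultimately have pos: "0 < g s" if "0 < s" "s < e3" for s using that by force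
  define t where "t = min e1 (min e2 e3) / 2"
  have t: "0 < t" "t < e1" "t < e2" "t < e3" using e1(1) e2(1) e3(1) by (auto simp: t_def)
  obtain s where "0 < s" "s < t" "h t - h 0 = (t - 0) * g s"
    using MVT2[of 0 t h g] e1(2) t by auto
  then have "h 0 < h t" using pos[of s] t by (smt (verit) mult_pos_pos)
  with e2(2)[of t] t show False by simp
qed

lemma eventually_line:
  assumes "open U" "z \<in> U"
  shows "\<forall>\<^sub>F s in nhds 0. z + s *\<^sub>R (v :: 'a::real_normed_vector) \<in> U"
proof -
  have "((\<lambda>s. z + s *\<^sub>R v) \<longlongrightarrow> z + 0 *\<^sub>R v) (nhds (0::real))"
    by (intro tendsto_intros) (simp add: filterlim_def)
  then show ?thesis using assms by (auto dest: topological_tendstoD)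
qed

lemma line2_local_max:
  assumes "line2 f z a D" "open U" "z \<in> U" "\<And>y. y \<in> U \<Longrightarrow> f y \<le> f z"
  shows "D \<le> 0"
proof -
  obtain f' where f': "\<forall>\<^sub>F s in nhds 0. ((\<lambda>s. f (z + s *\<^sub>R hdir z a)) has_real_derivative f' s) (at s)"
      "(f' has_real_derivative D) (at 0)"
    using assms unfolding line2_def by blast
  show ?thesis
  proof (rule second_derivative_local_max[OF f'])
    show "\<forall>\<^sub>F s in nhds 0. f (z + s *\<^sub>R hdir z a) \<le> f (z + 0 *\<^sub>R hdir z a)"
      using eventually_line[OF assms(2,3), of "hdir z a"] by eventually_elim (simp add: assms(4))
  qed
qed

section \<open>Lines and the horizontal fields\<close>

lemma hdir_eq_sum: "hdir z a = (\<Sum>i\<in>UNIV. a $ i *\<^sub>R Xdir i z)"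
proof (rule prod_eqI)
  show "fst (hdir z a) = fst (\<Sum>i\<in>UNIV. a $ i *\<^sub>R Xdir i z)"
    using basis_expansion[of a] by (simp add: hdir_def Xdir_def fst_sum scalar_mult_eq_scaleR)
  show "snd (hdir z a) = snd (\<Sum>i\<in>UNIV. a $ i *\<^sub>R Xdir i z)"
    by (simp add: hdir_def Xdir_def snd_sum inner_vec_def sum_distrib_left algebra_simps)
qed

text \<open>This is <Ja, a> = 0: the integral curves of a left-invariant horizontal field are
  straight lines.\<close>

lemma hdir_along_line: "hdir (z + s *\<^sub>R hdir z a) a = hdir z a"
  by (simp add: hdir_def matrix_vector_right_distrib matrix_vector_mult_scaleR inner_add)

lemma frechet_derivative_hdir:
  assumes "u differentiable (at z)"
  shows "frechet_derivative u (at z) (hdir z a) = (\<Sum>i\<in>UNIV. a $ i * Xf i u z)"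
proof -
  interpret linear "frechet_derivative u (at z)"
    by (rule linear_frechet_derivative[OF assms])
  show ?thesis by (simp add: hdir_eq_sum sum scale Xf_def)
qed

text \<open>\<open>C2_on\<close> speaks of derivatives in fixed directions, whereas
  \<open>Xdir j\<close> varies with the point. Splitting it into a constant direction and a linear
  multiple of the vertical one reduces the claim to products of differentiable functions.\<close>

lemma Xf_differentiable:
  fixes u :: "'n::finite hpt \<Rightarrow> real"
  assumes "open S" "C2_on S u" "z \<in> S"
  shows "Xf j u differentiable (at z)"
proof -
  define w where "w = (\<lambda>y. frechet_derivative u (at y) (axis j 1, 0)
      + 2 * (Jmat *v fst y) $ j * frechet_derivative u (at y) (0, 1))"
  have eq: "Xf j u y = w y" if "y \<in> S" for y
  proof -
    interpret linear "frechet_derivative u (at y)"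
      using assms that by (intro linear_frechet_derivative) (auto simp: C2_on_def)
    have "Xdir j y = (axis j 1, 0) + (2 * (Jmat *v fst y) $ j) *\<^sub>R (0, 1)"
      by (simp add: Xdir_def)
    then show ?thesis unfolding Xf_def w_def by (simp only: add scale) simp
  qed
  have "bounded_linear (\<lambda>y :: 'n hpt. (Jmat *v fst y) $ j)"
    by (intro bounded_linear_compose[OF bounded_linear_vec_nth] bounded_linear_compose[OF matrix_vector_mul_bounded_linear] bounded_linear_fst)
  then have "(\<lambda>y :: 'n hpt. (Jmat *v fst y) $ j) differentiable (at z)"
    by (rule bounded_linear_imp_differentiable)
  then have "w differentiable (at z)"
    unfolding w_def using assms by (intro derivative_intros) (auto simp: C2_on_def)
  then obtain W where "(w has_derivative W) (at z)" by (auto simp: differentiable_def)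
  then have "(Xf j u has_derivative W) (at z)"
    by (rule has_derivative_transform_within_open[OF _ assms(1,3)]) (simp add: eq)
  then show ?thesis by (auto simp: differentiable_def)
qed

text \<open>The velocity of the line is the value of one horizontal field at each of its points, so
  every derivative in s applies that field once more.\<close>

lemma line2_C2:
  fixes u :: "'n::finite hpt \<Rightarrow> real"
  assumes S: "open S" and u: "C2_on S u" and z: "z \<in> S"
  shows "line2 u z a (\<Sum>i\<in>UNIV. \<Sum>j\<in>UNIV. a $ i * a $ j * Xf i (Xf j u) z)"
proof -
  let ?p = "\<lambda>s. z + s *\<^sub>R hdir z a"
  have line: "(?p has_derivative (\<lambda>t. t *\<^sub>R hdir z a)) (at s)" for s
    by (auto intro!: derivative_eq_intros)
  have along: "((\<lambda>s. f (?p s)) has_real_derivative (\<Sum>i\<in>UNIV. a $ i * Xf i f (?p s))) (at s)"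
    if f: "f differentiable (at (?p s))" for f s
  proof -
    have "((\<lambda>s. f (?p s)) has_derivative (\<lambda>t. frechet_derivative f (at (?p s)) (t *\<^sub>R hdir z a))) (at s)"
      using has_derivative_compose[OF line, of f] f by (simp add: frechet_derivative_works)
    moreover have "frechet_derivative f (at (?p s)) (t *\<^sub>R hdir z a)
        = (\<Sum>i\<in>UNIV. a $ i * Xf i f (?p s)) * t" for t
      using frechet_derivative_hdir[OF f, of a]
      by (simp add: hdir_along_line linear_cmul[OF linear_frechet_derivative[OF f]])
    ultimately show ?thesis by (simp add: has_field_derivative_def)
  qed
  define g where "g s = (\<Sum>j\<in>UNIV. a $ j * Xf j u (?p s))" for s
  have "\<forall>\<^sub>F s in nhds 0. ((\<lambda>s. u (?p s)) has_real_derivative g s) (at s)"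
    using eventually_line[OF S z] unfolding g_def
    by eventually_elim (rule along, use u in \<open>auto simp: C2_on_def\<close>)
  moreover have "(g has_real_derivative (\<Sum>j\<in>UNIV. a $ j * (\<Sum>i\<in>UNIV. a $ i * Xf i (Xf j u) (?p 0)))) (at 0)"
    unfolding g_def using Xf_differentiable[OF S u z]
    by (intro DERIV_sum DERIV_cmult along) simp
  moreover have "(\<Sum>j\<in>UNIV. a $ j * (\<Sum>i\<in>UNIV. a $ i * Xf i (Xf j u) (?p 0)))
      = (\<Sum>i\<in>UNIV. \<Sum>j\<in>UNIV. a $ i * a $ j * Xf i (Xf j u) z)"
    by (subst sum.swap) (simp add: sum_distrib_left algebra_simps)
  ultimately show ?thesis unfolding line2_def by auto
qed

text \<open>A sum of squares is symmetric in i and j, so contracting with it gives the same result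
  for X_i X_j as for the symmetrised \<open>hhess\<close>.\<close>

lemma LA_eq_sum:
  fixes b :: "'k::finite \<Rightarrow> real^('n::finite + 'n)"
  assumes "\<And>i j. A z $ i $ j = (\<Sum>k\<in>UNIV. b k $ i * b k $ j)"
  shows "LA A u z = (\<Sum>k\<in>UNIV. \<Sum>i\<in>UNIV. \<Sum>j\<in>UNIV. b k $ i * b k $ j * Xf i (Xf j u) z)"
proof -
  define T where "T i j = Xf i (Xf j u) z" for i j
  have "LA A u z = (\<Sum>i\<in>UNIV. \<Sum>j\<in>UNIV. A z $ i $ j * ((T j i + T i j) / 2))"
    by (simp add: LA_def trace_def matrix_matrix_mult_def hhess_def T_def)
  also have "\<dots> = (\<Sum>i\<in>UNIV. \<Sum>j\<in>UNIV. A z $ i $ j * T j i) / 2 + (\<Sum>i\<in>UNIV. \<Sum>j\<in>UNIV. A z $ i $ j * T i j) / 2"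
    by (simp add: sum.distrib sum_divide_distrib add_divide_distrib distrib_left)
  also have "(\<Sum>i\<in>UNIV. \<Sum>j\<in>UNIV. A z $ i $ j * T j i) = (\<Sum>i\<in>UNIV. \<Sum>j\<in>UNIV. A z $ i $ j * T i j)"
    by (subst sum.swap) (simp add: assms mult.commute)
  also have "(\<Sum>i\<in>UNIV. \<Sum>j\<in>UNIV. A z $ i $ j * T i j) = (\<Sum>i\<in>UNIV. \<Sum>j\<in>UNIV. \<Sum>k\<in>UNIV. b k $ i * b k $ j * T i j)"
    by (simp add: assms sum_distrib_right)
  also have "\<dots> = (\<Sum>k\<in>UNIV. \<Sum>i\<in>UNIV. \<Sum>j\<in>UNIV. b k $ i * b k $ j * T i j)"
    by (simp add: sum.swap[of _ "UNIV :: 'k set"])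
  finally show ?thesis by (simp add: T_def)
qed

lemma inner_matrix_sum_squares:
  fixes b :: "'k::finite \<Rightarrow> real^'m::finite"
  assumes "\<And>i j. B $ i $ j = (\<Sum>k\<in>UNIV. b k $ i * b k $ j)"
  shows "x \<bullet> (B *v y) = (\<Sum>k\<in>UNIV. (b k \<bullet> x) * (b k \<bullet> y))"
proof -
  have "x \<bullet> (B *v y) = (\<Sum>i\<in>UNIV. \<Sum>j\<in>UNIV. \<Sum>k\<in>UNIV. (b k $ i * x $ i) * (b k $ j * y $ j))"
    by (simp add: inner_vec_def matrix_vector_mult_def assms sum_distrib_left sum_distrib_right ac_simps)
  also have "\<dots> = (\<Sum>k\<in>UNIV. \<Sum>i\<in>UNIV. \<Sum>j\<in>UNIV. (b k $ i * x $ i) * (b k $ j * y $ j))"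
    by (simp add: sum.swap[of _ "UNIV :: 'k set"])
  also have "\<dots> = (\<Sum>k\<in>UNIV. (b k \<bullet> x) * (b k \<bullet> y))"
    by (simp add: inner_vec_def sum_product)
  finally show ?thesis .
qed

subsection \<open>Sums of squares and comparison\<close>

lemma symmetric_matrix_inner:
  fixes B :: "real^'m::finite^'m"
  assumes "transpose B = B"
  shows "x \<bullet> (B *v y) = (B *v x) \<bullet> y"
  by (metis assms dot_lmul_matrix vector_transpose_matrix)

lemma inner_axis_matrix_axis: "axis i 1 \<bullet> (B *v axis j 1) = (B :: real^'m::finite^'m) $ i $ j"
  by (simp add: matrix_vector_mult_basis inner_axis' column_def)

text \<open>Gaussian elimination: subtract the square of one row and induct on the support.\<close>
lemma psd_sum_squares_aux:
  fixes B :: "real^'m::finite^'m"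
  assumes "finite S" "transpose B = B" "\<And>x. 0 \<le> x \<bullet> (B *v x)"
    "\<And>i j. B $ i $ j \<noteq> 0 \<Longrightarrow> i \<in> S \<and> j \<in> S"
  shows "\<exists>b :: 'm \<Rightarrow> real^'m. \<forall>i j. B $ i $ j = (\<Sum>k\<in>S. b k $ i * b k $ j)"
  using assms
proof (induction S arbitrary: B rule: finite_induct)
  case empty
  then show ?case by auto
next
  case (insert p S)
  have sym: "B $ i $ j = B $ j $ i" for i j
    using insert.prems(1) by (metis transpose_def vec_lambda_beta)
  have quad: "(s *\<^sub>R axis i 1 + x) \<bullet> (B *v (s *\<^sub>R axis i 1 + x))
     = s\<^sup>2 * B $ i $ i + 2 * s * ((B *v axis i 1) \<bullet> x) + x \<bullet> (B *v x)" for s i x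
    using symmetric_matrix_inner[OF insert.prems(1), of x "axis i 1"]
      symmetric_matrix_inner[OF insert.prems(1), of "axis i 1" x]
    by (simp add: matrix_vector_right_distrib matrix_vector_mult_scaleR inner_add
        inner_axis_matrix_axis power2_eq_square inner_commute[of x] algebra_simps)
  have Bpp: "0 \<le> B $ p $ p"
    using insert.prems(2)[of "axis p 1"] by (simp add: inner_axis_matrix_axis)
  define c where "c = B *v axis p 1"
  have c_nth: "c $ i = B $ i $ p" for i
    by (simp add: c_def matrix_vector_mult_basis column_def)
  define B' where "B' = (\<chi> i j. B $ i $ j - c $ i * c $ j / B $ p $ p)"
  \<comment> \<open>A zero pivot forces a zero row: otherwise the form at s e_p + e_i would be
    affine in s with nonzero slope, and the chosen s gives it the value -1. In that case the
    division by zero in \<open>B'\<close> subtracts nothing.\<close>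
  have zero: "c $ i = 0" if "B $ p $ p = 0" for i
  proof (rule ccontr)
    assume ne: "c $ i \<noteq> 0"
    define s where "s = - (B $ i $ i + 1) / (2 * c $ i)"
    have "0 \<le> 2 * s * c $ i + B $ i $ i"
      using insert.prems(2)[of "s *\<^sub>R axis p 1 + axis i 1"] unfolding quad c_def[symmetric]
      by (simp add: that inner_axis inner_axis_matrix_axis)
    moreover have "2 * s * c $ i = - (B $ i $ i + 1)" using ne by (simp add: s_def)
    ultimately show False by linarith
  qed
  have qB': "x \<bullet> (B' *v x) = x \<bullet> (B *v x) - (c \<bullet> x)\<^sup>2 / B $ p $ p" for x
  proof -
    have "x \<bullet> (B' *v x) = (\<Sum>i\<in>UNIV. \<Sum>j\<in>UNIV. x $ i * (B $ i $ j * x $ j) - (c $ i * x $ i) * (c $ j * x $ j) / B $ p $ p)"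
      by (simp add: inner_vec_def matrix_vector_mult_def B'_def sum_distrib_left algebra_simps)
    also have "\<dots> = x \<bullet> (B *v x) - (c \<bullet> x)\<^sup>2 / B $ p $ p"
    proof -
      have "(c \<bullet> x)\<^sup>2 = (\<Sum>i\<in>UNIV. \<Sum>j\<in>UNIV. (c $ i * x $ i) * (c $ j * x $ j))"
        by (simp add: inner_vec_def power2_eq_square sum_product)
      then show ?thesis
        by (simp add: inner_vec_def matrix_vector_mult_def sum_subtractf sum_distrib_left sum_divide_distrib)
    qed
    finally show ?thesis .
  qed
  have "\<exists>b :: 'm \<Rightarrow> real^'m. \<forall>i j. B' $ i $ j = (\<Sum>k\<in>S. b k $ i * b k $ j)"
  proof (rule insert.IH)
    show "transpose B' = B'"
      by (simp add: vec_eq_iff transpose_def B'_def sym mult.commute)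
  next
    fix x
    show "0 \<le> x \<bullet> (B' *v x)"
    proof (cases "B $ p $ p = 0")
      case True then show ?thesis using insert.prems(2)[of x] by (simp add: qB')
    next
      case False
      then have pos: "0 < B $ p $ p" using Bpp by simp
      \<comment> \<open>This s minimises the form along the direction e_p, which completes the
        square.\<close>
      define s where "s = - (c \<bullet> x) / B $ p $ p"
      have "0 \<le> s\<^sup>2 * B $ p $ p + 2 * s * (c \<bullet> x) + x \<bullet> (B *v x)"
        using insert.prems(2)[of "s *\<^sub>R axis p 1 + x"] unfolding quad c_def[symmetric] .
      also have "s\<^sup>2 * B $ p $ p + 2 * s * (c \<bullet> x) = - ((c \<bullet> x)\<^sup>2 / B $ p $ p)"
        using pos by (simp add: s_def power2_eq_square field_simps)
      finally show ?thesis by (simp add: qB')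
    qed
  next
    fix i j
    assume nz: "B' $ i $ j \<noteq> 0"
    \<comment> \<open>Elimination clears row and column p, so the support shrinks to
      \<open>S\<close>.\<close>
    have "B' $ i $ p = 0" "B' $ p $ i = 0" for i
      using zero[of i] c_nth[of p] sym[of p i] c_nth[of i] by (cases "B $ p $ p = 0"; simp add: B'_def)+
    then have "i \<noteq> p" "j \<noteq> p" using nz by auto
    moreover have "B $ i $ j \<noteq> 0 \<or> (B $ i $ p \<noteq> 0 \<and> B $ j $ p \<noteq> 0)"
      using nz by (auto simp: B'_def c_nth)
    ultimately show "i \<in> S \<and> j \<in> S" using insert.prems(3) by blast
  qed
  then obtain b :: "'m \<Rightarrow> real^'m" where b: "\<And>i j. B' $ i $ j = (\<Sum>k\<in>S. b k $ i * b k $ j)" by blast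
  \<comment> \<open>For a zero pivot the new vector is 0, since \<open>1 / sqrt 0\<close> is 0; this
    agrees with \<open>B' = B\<close> in that case.\<close>
  define b' where "b' = b(p := (1 / sqrt (B $ p $ p)) *\<^sub>R c)"
  have "B $ i $ j = (\<Sum>k\<in>insert p S. b' k $ i * b' k $ j)" for i j
  proof -
    have "(\<Sum>k\<in>S. b' k $ i * b' k $ j) = (\<Sum>k\<in>S. b k $ i * b k $ j)"
      using insert.hyps(2) by (intro sum.cong) (auto simp: b'_def)
    moreover have "b' p $ i * b' p $ j = c $ i * c $ j / B $ p $ p"
      using Bpp by (simp add: b'_def)
    ultimately show ?thesis using insert.hyps b[of i j] by (simp add: B'_def)
  qed
  then show ?case by blast
qed

lemma psd_sum_squares:
  fixes B :: "real^'m::finite^'m"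
  assumes "transpose B = B" "\<And>x. 0 \<le> x \<bullet> (B *v x)"
  obtains b :: "'m \<Rightarrow> real^'m" where "\<And>i j. B $ i $ j = (\<Sum>k\<in>UNIV. b k $ i * b k $ j)"
  using psd_sum_squares_aux[of UNIV B] assms by auto

text \<open>The equation \<open>\<L>\<^sub>A w = 0\<close> at \<open>z\<close>, with \<open>\<L>\<^sub>A\<close> written as a sum of second derivatives along lines.
  Unlike \<open>LA\<close> this is visibly stable under \<open>w \<mapsto> c - w\<close>.\<close>
definition solves :: "('n::finite hpt \<Rightarrow> real^('n + 'n)^('n + 'n)) \<Rightarrow> ('n hpt \<Rightarrow> real) \<Rightarrow> 'n hpt \<Rightarrow> bool" where
  "solves A w z \<longleftrightarrow> (\<forall>b :: 'n + 'n \<Rightarrow> real^('n + 'n).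
     (\<forall>i j. A z $ i $ j = (\<Sum>k\<in>UNIV. b k $ i * b k $ j)) \<longrightarrow>
     (\<exists>D. (\<forall>k. line2 w z (b k) (D k)) \<and> (\<Sum>k\<in>UNIV. D k) = 0))"

lemma solves_C2:
  assumes "open S" "C2_on S u" "z \<in> S" "LA A u z = 0"
  shows "solves A u z"
  unfolding solves_def
proof (intro allI impI)
  fix b :: "'a + 'a \<Rightarrow> real^('a + 'a)"
  assume b: "\<forall>i j. A z $ i $ j = (\<Sum>k\<in>UNIV. b k $ i * b k $ j)"
  show "\<exists>D. (\<forall>k. line2 u z (b k) (D k)) \<and> (\<Sum>k\<in>UNIV. D k) = 0"
    using line2_C2[OF assms(1-3)] LA_eq_sum[of A z b u] b assms(4)
    by (intro exI[of _ "\<lambda>k. \<Sum>i\<in>UNIV. \<Sum>j\<in>UNIV. b k $ i * b k $ j * Xf i (Xf j u) z"]) auto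
qed

lemma solves_const_diff:
  assumes "solves A w z"
  shows "solves A (\<lambda>z. c - w z) z"
  unfolding solves_def
proof (intro allI impI)
  fix b :: "'a + 'a \<Rightarrow> real^('a + 'a)"
  assume "\<forall>i j. A z $ i $ j = (\<Sum>k\<in>UNIV. b k $ i * b k $ j)"
  then obtain D where D: "\<And>k. line2 w z (b k) (D k)" "(\<Sum>k\<in>UNIV. D k) = 0"
    using assms unfolding solves_def by blast
  show "\<exists>D. (\<forall>k. line2 (\<lambda>z. c - w z) z (b k) (D k)) \<and> (\<Sum>k\<in>UNIV. D k) = 0"
    using line2_diff[OF line2_const[of c] D(1)] D(2)
    by (intro exI[of _ "\<lambda>k. 0 - D k"]) (auto simp: sum_negf)
qed

text \<open>A maximum principle. The first alternative is meant for the boundary and the second for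
  interior points. At a maximum of \<open>v - w\<close> over \<open>G\<close> the second one fails,
  because there each \<open>D k - E k\<close> is at most 0.\<close>

lemma comparison:
  fixes v w :: "'n::finite hpt \<Rightarrow> real"
  assumes G: "compact G" and cont: "continuous_on G v" "continuous_on G w"
    and cases: "\<And>z. z \<in> G \<Longrightarrow> v z \<le> w z \<or> (\<exists>U. open U \<and> z \<in> U \<and> U \<subseteq> G \<and>
       (\<exists>(b :: 'n + 'n \<Rightarrow> real^('n + 'n)) D E. (\<forall>k. line2 v z (b k) (D k)) \<and> (\<forall>k. line2 w z (b k) (E k))
           \<and> (\<Sum>k\<in>UNIV. E k) < (\<Sum>k\<in>UNIV. D k)))"
    and z: "z \<in> G"
  shows "v z \<le> w z"
proof -
  have "continuous_on G (\<lambda>z. v z - w z)" using cont by (intro continuous_intros)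
  then obtain x where x: "x \<in> G" "\<And>y. y \<in> G \<Longrightarrow> v y - w y \<le> v x - w x"
    using continuous_attains_sup[OF G] z by blast
  have "v x \<le> w x"
  proof (rule ccontr)
    assume "\<not> v x \<le> w x"
    then obtain U and b :: "'n + 'n \<Rightarrow> real^('n + 'n)" and D E where
      U: "open U" "x \<in> U" "U \<subseteq> G" and DE: "\<And>k. line2 v x (b k) (D k)" "\<And>k. line2 w x (b k) (E k)"
      and less: "(\<Sum>k\<in>UNIV. E k) < (\<Sum>k\<in>UNIV. D k)"
      using cases[OF x(1)] by blast
    have "D k - E k \<le> 0" for k
      using line2_local_max[OF line2_diff[OF DE] U(1,2)] x(2) U(3) by blast
    then have "(\<Sum>k\<in>UNIV. D k) \<le> (\<Sum>k\<in>UNIV. E k)" by (intro sum_mono) simp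
    then show False using less by simp
  qed
  then show ?thesis using x(2)[OF z] by simp
qed

subsection \<open>The frozen-coefficient barrier\<close>

text \<open>The fourth power of the gauge of \<zeta>^(-1) o z with |y|^2 replaced by <Py, y>. For
  the identity matrix \<open>P\<close> it is \<open>hdist \<zeta> z ^ 4\<close>.\<close>

definition gphi :: "real^('n + 'n)^('n + 'n) \<Rightarrow> 'n::finite hpt \<Rightarrow> 'n hpt \<Rightarrow> real" where
  "gphi P \<zeta> z = ((fst z - fst \<zeta>) \<bullet> (P *v (fst z - fst \<zeta>)))\<^sup>2 + (hrel \<zeta> z)\<^sup>2"

lemma gphi_line:
  fixes P :: "real^('n::finite + 'n)^('n + 'n)" and z \<zeta> :: "'n hpt"
  assumes P: "transpose P = P"
  defines "y \<equiv> fst z - fst \<zeta>"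
  shows "gphi P \<zeta> (z + s *\<^sub>R hdir z a) =
     (y \<bullet> (P *v y) + 2 * s * ((P *v y) \<bullet> a) + s\<^sup>2 * (a \<bullet> (P *v a)))\<^sup>2
     + (hrel \<zeta> z + 2 * s * ((Jmat *v y) \<bullet> a))\<^sup>2"
proof -
  have "fst (z + s *\<^sub>R hdir z a) - fst \<zeta> = y + s *\<^sub>R a"
    by (simp add: y_def hdir_def)
  moreover have "(y + s *\<^sub>R a) \<bullet> (P *v (y + s *\<^sub>R a))
     = y \<bullet> (P *v y) + 2 * s * ((P *v y) \<bullet> a) + s\<^sup>2 * (a \<bullet> (P *v a))"
    using symmetric_matrix_inner[OF P, of y a]
    by (simp add: matrix_vector_right_distrib matrix_vector_mult_scaleR inner_add
        power2_eq_square inner_commute[of a] algebra_simps)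
  moreover have "hrel \<zeta> (z + s *\<^sub>R hdir z a) = hrel \<zeta> z + 2 * s * ((Jmat *v y) \<bullet> a)"
    by (simp add: hrel_def hdir_def y_def matrix_vector_mult_diff_distrib inner_add inner_diff algebra_simps)
  ultimately show ?thesis by (simp add: gphi_def)
qed

lemma line2_gphi_powr:
  fixes P :: "real^('n::finite + 'n)^('n + 'n)" and z \<zeta> :: "'n hpt"
  assumes P: "transpose P = P" and pos: "0 < gphi P \<zeta> z"
  defines "y \<equiv> fst z - fst \<zeta>"
  shows "line2 (\<lambda>z. gphi P \<zeta> z powr (-m)) z a
    (m * (m + 1) * gphi P \<zeta> z powr (-m-2) * 16 * ((y \<bullet> (P *v y)) * ((P *v y) \<bullet> a) + hrel \<zeta> z * ((Jmat *v y) \<bullet> a))\<^sup>2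
     - m * gphi P \<zeta> z powr (-m-1) * (8 * ((P *v y) \<bullet> a)\<^sup>2 + 4 * (y \<bullet> (P *v y)) * (a \<bullet> (P *v a)) + 8 * ((Jmat *v y) \<bullet> a)\<^sup>2))"
    (is "line2 _ _ _ ?D")
proof -
  define q p c t j where "q = y \<bullet> (P *v y)" and "p = (P *v y) \<bullet> a" and "c = a \<bullet> (P *v a)"
    and "t = hrel \<zeta> z" and "j = (Jmat *v y) \<bullet> a"
  \<comment> \<open>Along the line \<open>gphi\<close> is a quartic polynomial \<open>f\<close> in
    s, with derivatives \<open>f1\<close> and \<open>f2\<close>. It stays positive near s = 0, so
    its real powers can be differentiated there.\<close>
  define f f1 f2 where "f s = (q + 2 * s * p + s\<^sup>2 * c)\<^sup>2 + (t + 2 * s * j)\<^sup>2"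
    and "f1 s = 2 * (q + 2 * s * p + s\<^sup>2 * c) * (2 * p + 2 * s * c) + 4 * (t + 2 * s * j) * j"
    and "f2 s = 2 * (2 * p + 2 * s * c)\<^sup>2 + 4 * (q + 2 * s * p + s\<^sup>2 * c) * c + 8 * j\<^sup>2" for s :: real
  have f: "(f has_real_derivative f1 s) (at s)" for s
    unfolding f_def f1_def by (auto intro!: derivative_eq_intros simp: algebra_simps)
  have f1: "(f1 has_real_derivative f2 s) (at s)" for s
    unfolding f1_def f2_def by (auto intro!: derivative_eq_intros simp: algebra_simps power2_eq_square)
  have f0: "f 0 = gphi P \<zeta> z"
    by (simp add: f_def gphi_def q_def t_def y_def)
  have line: "gphi P \<zeta> (z + s *\<^sub>R hdir z a) = f s" for s
    unfolding gphi_line[OF P] f_def q_def p_def c_def t_def j_def y_def by simp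
  define g where "g s = - m * f s powr (-m - 1) * f1 s" for s
  have "continuous_on UNIV f" 
    by (intro continuous_at_imp_continuous_on ballI DERIV_isCont[OF f])
  then have "open {s. 0 < f s}" by (intro open_Collect_less continuous_intros)
  then have "\<forall>\<^sub>F s in nhds 0. s \<in> {s. 0 < f s}"
    using pos f0 by (intro eventually_nhds_in_open) auto
  then have "\<forall>\<^sub>F s in nhds 0. ((\<lambda>s. f s powr (-m)) has_real_derivative g s) (at s)"
    by eventually_elim (auto intro!: derivative_eq_intros f simp: g_def)
  moreover have "(g has_real_derivative ?D) (at 0)"
  proof -
    have e: "-m - 1 - 1 = -m - 2" by simp
    have "((\<lambda>s. f s powr (-m - 1)) has_real_derivative (-m - 1) * f 0 powr (-m - 2) * f1 0) (at 0)"
      unfolding e[symmetric] using pos f0 by (auto intro!: derivative_eq_intros f)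
    from DERIV_mult[OF DERIV_cmult[OF this, of "- m"] f1]
    have "(g has_real_derivative - m * ((-m - 1) * f 0 powr (-m - 2) * f1 0) * f1 0
        + f2 0 * (- m * f 0 powr (-m - 1))) (at 0)"
      unfolding g_def .
    moreover have "f1 0 = 4 * (q * p + t * j)" "f2 0 = 8 * p\<^sup>2 + 4 * q * c + 8 * j\<^sup>2"
      by (simp_all add: f1_def f2_def algebra_simps)
    ultimately show ?thesis
      unfolding q_def[symmetric] p_def[symmetric] c_def[symmetric] t_def[symmetric] j_def[symmetric] f0[symmetric]
      by (elim DERIV_cong) (simp add: power2_eq_square algebra_simps)
  qed
  ultimately show ?thesis unfolding line2_def line by blast
qed

text \<open>What symplecticity gives at one point: \<open>P\<close> inverts \<open>A\<close>, and
  its quadratic form is that of J^t A J.\<close>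

definition gauge_pair :: "real^('n::finite + 'n)^('n + 'n) \<Rightarrow> real^('n + 'n)^('n + 'n) \<Rightarrow> bool" where
  "gauge_pair A P \<longleftrightarrow> transpose A = A \<and> transpose P = P \<and> A ** P = mat 1 \<and>
     (\<forall>y. y \<bullet> (P *v y) = (Jmat *v y) \<bullet> (A *v (Jmat *v y)))"

lemma barrier_subsolution:
  fixes A P B :: "real^('n::finite + 'n)^('n + 'n)"
  assumes AP: "gauge_pair A P" and A: "\<And>x. 0 \<le> x \<bullet> (A *v x)"
    and lo: "\<And>x. (1 - \<kappa>) * (x \<bullet> (A *v x)) \<le> x \<bullet> (B *v x)"
    and up: "\<And>x. x \<bullet> (B *v x) \<le> (1 + \<kappa>) * (x \<bullet> (A *v x))"
    and b: "\<And>i j. B $ i $ j = (\<Sum>k\<in>UNIV. b k $ i * b k $ j)"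
    and \<kappa>: "\<kappa> * (2 * real CARD('n + 'n) + 9) \<le> 1"
    and pos: "0 < gphi P \<zeta> z"
  obtains D where "\<And>k. line2 (\<lambda>z. gphi P \<zeta> z powr (- ((real CARD('n + 'n) + 1) / 4))) z (b k) (D k)"
    and "0 \<le> (\<Sum>k\<in>UNIV. D (k :: 'n + 'n))"
proof -
  define N where "N = real CARD('n + 'n)"
  define m where "m = (N + 1) / 4"
  have m: "0 < m" by (simp add: m_def N_def add_nonneg_pos)
  define y where "y = fst z - fst \<zeta>"
  define p j where "p = P *v y" and "j = Jmat *v y"
  define q t \<phi> where "q = y \<bullet> p" and "t = hrel \<zeta> z" and "\<phi> = gphi P \<zeta> z"
  have \<phi>: "\<phi> = q\<^sup>2 + t\<^sup>2" by (simp add: \<phi>_def gphi_def q_def p_def t_def y_def)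
  have \<phi>pos: "0 < \<phi>" using pos by (simp add: \<phi>_def)
  have sym: "transpose A = A" "transpose P = P" using AP by (auto simp: gauge_pair_def)
  have Ap: "A *v p = y" using AP by (simp add: p_def gauge_pair_def matrix_vector_mul_assoc)
  have pAp: "p \<bullet> (A *v p) = q" by (simp add: Ap q_def inner_commute)
  have jAj: "j \<bullet> (A *v j) = q" using AP by (simp add: gauge_pair_def q_def j_def p_def)
  have pAj: "p \<bullet> (A *v j) = 0"
    using symmetric_matrix_inner[OF sym(1), of p j] by (simp add: Ap j_def)
  have jAp: "j \<bullet> (A *v p) = 0" by (simp add: Ap j_def)
  define V where "V = q *\<^sub>R p + t *\<^sub>R j"
  have VAV: "V \<bullet> (A *v V) = q * \<phi>"
    by (simp add: V_def matrix_vector_right_distrib matrix_vector_mult_scaleR inner_add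
        pAp jAj pAj jAp \<phi> power2_eq_square algebra_simps)
  have q: "0 \<le> q" using A[of j] jAj by simp
  have sq: "(\<Sum>k\<in>UNIV. (x \<bullet> b k)\<^sup>2) = x \<bullet> (B *v x)" for x
    by (simp add: inner_matrix_sum_squares[OF b] power2_eq_square inner_commute)
  \<comment> \<open>The sum is tr(BP). With P written as a sum of squares of vectors
    \<open>c l\<close> it becomes the sum of <B c_l, c_l>, where the form bound applies term by
    term; the same sum for \<open>A\<close> is tr(AP) = N.\<close>
  have tr: "(\<Sum>k\<in>UNIV. b k \<bullet> (P *v b k)) \<le> (1 + \<kappa>) * N"
  proof -
    have "0 \<le> x \<bullet> (P *v x)" for x using AP A by (simp add: gauge_pair_def)
    then obtain c :: "'n + 'n \<Rightarrow> real^('n + 'n)" where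
      c: "\<And>i j. P $ i $ j = (\<Sum>k\<in>UNIV. c k $ i * c k $ j)"
      using psd_sum_squares[OF sym(2)] by blast
    have "(\<Sum>k\<in>UNIV. b k \<bullet> (P *v b k)) = (\<Sum>k\<in>UNIV. \<Sum>l\<in>UNIV. (c l \<bullet> b k)\<^sup>2)"
      by (simp add: inner_matrix_sum_squares[OF c] power2_eq_square)
    also have "\<dots> = (\<Sum>l\<in>UNIV. c l \<bullet> (B *v c l))"
      by (subst sum.swap) (simp add: sq)
    also have "\<dots> \<le> (\<Sum>l\<in>UNIV. (1 + \<kappa>) * (c l \<bullet> (A *v c l)))"
      by (intro sum_mono up)
    also have "\<dots> = (1 + \<kappa>) * (\<Sum>l\<in>UNIV. c l \<bullet> (A *v c l))"
      by (simp add: sum_distrib_left)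
    also have "(\<Sum>l\<in>UNIV. c l \<bullet> (A *v c l)) = (\<Sum>l\<in>UNIV. \<Sum>i\<in>UNIV. \<Sum>j\<in>UNIV. A $ i $ j * (c l $ j * c l $ i))"
      by (simp add: inner_vec_def matrix_vector_mult_def sum_distrib_left algebra_simps)
    also have "\<dots> = (\<Sum>i\<in>UNIV. \<Sum>j\<in>UNIV. A $ i $ j * P $ j $ i)"
      by (subst sum.swap, rule sum.cong[OF refl], subst sum.swap) (simp add: c sum_distrib_left)
    also have "\<dots> = trace (A ** P)" by (simp add: trace_def matrix_matrix_mult_def)
    also have "\<dots> = N" using AP by (simp add: gauge_pair_def trace_def mat_def N_def)
    finally show ?thesis .
  qed
  define D where "D k = m * (m + 1) * \<phi> powr (-m-2) * 16 * (V \<bullet> b k)\<^sup>2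
     - m * \<phi> powr (-m-1) * (8 * (p \<bullet> b k)\<^sup>2 + 4 * q * (b k \<bullet> (P *v b k)) + 8 * (j \<bullet> b k)\<^sup>2)" for k
  have "line2 (\<lambda>z. gphi P \<zeta> z powr (- m)) z (b k) (D k)" for k
    using line2_gphi_powr[OF sym(2) pos, of m "b k"]
    by (simp add: D_def V_def p_def j_def y_def q_def t_def \<phi>_def inner_add)
  moreover have "0 \<le> (\<Sum>k\<in>UNIV. D k)"
  proof -
    define E where "E = \<phi> powr (-m-1)"
    have E: "0 < E" using \<phi>pos by (simp add: E_def)
    have E2: "\<phi> powr (-m-2) = E / \<phi>"
    proof -
      have "\<phi> powr (-m-2) = \<phi> powr ((-m-1) - 1)" by (simp add: algebra_simps)
      also have "\<dots> = E / \<phi>" using \<phi>pos by (subst powr_diff) (simp add: E_def)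
      finally show ?thesis .
    qed
    have "(\<Sum>k\<in>UNIV. D k) = m * (m + 1) * (E / \<phi>) * 16 * (V \<bullet> (B *v V))
       - m * E * (8 * (p \<bullet> (B *v p)) + 4 * q * (\<Sum>k\<in>UNIV. b k \<bullet> (P *v b k)) + 8 * (j \<bullet> (B *v j)))"
      unfolding D_def E_def[symmetric] E2 sum_subtractf sum_distrib_left[symmetric] sum.distrib sq by simp
    \<comment> \<open>The V term enters positively and uses the lower form bound, the other three
      enter negatively and use the upper one.\<close>
    also have "\<dots> \<ge> m * (m + 1) * (E / \<phi>) * 16 * ((1 - \<kappa>) * (q * \<phi>))
       - m * E * (8 * ((1 + \<kappa>) * q) + 4 * q * ((1 + \<kappa>) * N) + 8 * ((1 + \<kappa>) * q))"
      using lo[of V] up[of p] up[of j] tr m E \<phi>pos q unfolding VAV pAp jAj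
      by (intro diff_mono mult_left_mono add_mono) auto
    also have "m * (m + 1) * (E / \<phi>) * 16 * ((1 - \<kappa>) * (q * \<phi>))
       - m * E * (8 * ((1 + \<kappa>) * q) + 4 * q * ((1 + \<kappa>) * N) + 8 * ((1 + \<kappa>) * q))
       = m * E * q * 4 * (1 - \<kappa> * (2 * N + 9))"
      using \<phi>pos by (simp add: m_def field_simps)
    finally have "m * E * q * 4 * (1 - \<kappa> * (2 * N + 9)) \<le> (\<Sum>k\<in>UNIV. D k)" .
    moreover have "0 \<le> m * E * q * 4 * (1 - \<kappa> * (2 * N + 9))"
      using m E q \<kappa> by (simp add: N_def)
    ultimately show ?thesis by linarith
  qed
  ultimately show thesis using that[of D] unfolding m_def N_def by blast
qed

text \<open>J is an isometry and <Py, y> = <A Jy, Jy>, so \<open>P\<close> inherits the bounds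
  \<open>l\<close> and \<open>L\<close> of \<open>A\<close> itself. The assumption l <= 1 <= L takes
  care of the vertical term.\<close>

lemma gphi_bounds:
  fixes P :: "real^('n::finite + 'n)^('n + 'n)"
  assumes AP: "gauge_pair A P" and l: "0 < l" "l \<le> 1" "1 \<le> L"
    and A: "\<And>x. l * (x \<bullet> x) \<le> x \<bullet> (A *v x)" "\<And>x. x \<bullet> (A *v x) \<le> L * (x \<bullet> x)"
  shows "l\<^sup>2 * hdist \<zeta> z ^ 4 \<le> gphi P \<zeta> z" "gphi P \<zeta> z \<le> L\<^sup>2 * hdist \<zeta> z ^ 4"
proof -
  define y where "y = fst z - fst \<zeta>"
  have y: "y \<bullet> (P *v y) = (Jmat *v y) \<bullet> (A *v (Jmat *v y))"
    using AP by (simp add: gauge_pair_def)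
  have lo: "l * (norm y)\<^sup>2 \<le> y \<bullet> (P *v y)" and up: "y \<bullet> (P *v y) \<le> L * (norm y)\<^sup>2"
    using A[of "Jmat *v y"] by (simp_all add: y power2_norm_eq_inner)
  have g: "gphi P \<zeta> z = (y \<bullet> (P *v y))\<^sup>2 + (hrel \<zeta> z)\<^sup>2"
    and d: "hdist \<zeta> z ^ 4 = (norm y)^4 + (hrel \<zeta> z)\<^sup>2"
    by (simp_all add: gphi_def hdist_pow4 y_def)
  have "l\<^sup>2 * (norm y)^4 = (l * (norm y)\<^sup>2)\<^sup>2" "L\<^sup>2 * (norm y)^4 = (L * (norm y)\<^sup>2)\<^sup>2"
    by (simp_all add: power_mult_distrib)
  moreover have "(l * (norm y)\<^sup>2)\<^sup>2 \<le> (y \<bullet> (P *v y))\<^sup>2"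
    using lo l by (intro power_mono) auto
  moreover have "0 \<le> l * (norm y)\<^sup>2" using l by simp
  then have "(y \<bullet> (P *v y))\<^sup>2 \<le> (L * (norm y)\<^sup>2)\<^sup>2"
    using lo up by (intro power_mono) linarith+
  moreover have "l\<^sup>2 * (hrel \<zeta> z)\<^sup>2 \<le> 1 * (hrel \<zeta> z)\<^sup>2" "1 * (hrel \<zeta> z)\<^sup>2 \<le> L\<^sup>2 * (hrel \<zeta> z)\<^sup>2"
    using l by (intro mult_right_mono; simp add: power_le_one)+
  ultimately show "l\<^sup>2 * hdist \<zeta> z ^ 4 \<le> gphi P \<zeta> z" "gphi P \<zeta> z \<le> L\<^sup>2 * hdist \<zeta> z ^ 4"
    unfolding g d distrib_left by linarith+
qed

lemma symplectic_gauge_pair: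
  assumes "symplectic_on S A" "Mclass l L S A" "z \<in> S"
  shows "gauge_pair (A z) (matrix_inv (A z))"
proof -
  have A: "transpose (A z) = A z" "det (A z) = 1"
    using assms(2,3) by (auto simp: Mclass_def)
  have P: "matrix_inv (A z) = transpose Jmat ** A z ** Jmat"
    using assms(1,3) by (auto simp: symplectic_on_def)
  have "invertible (A z)" using A(2) by (simp add: invertible_det_nz)
  then have "A z ** matrix_inv (A z) = mat 1"
    unfolding invertible_def matrix_inv_def by (rule someI2_ex) simp
  moreover have "transpose (matrix_inv (A z)) = matrix_inv (A z)"
    unfolding P by (simp add: matrix_transpose_mul transpose_transpose A(1) matrix_mul_assoc)
  moreover have "y \<bullet> (matrix_inv (A z) *v y) = (Jmat *v y) \<bullet> (A z *v (Jmat *v y))" for y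
    unfolding P by (simp only: matrix_vector_mul_assoc[symmetric] transpose_Jmat_inner)
  ultimately show ?thesis using A(1) by (simp add: gauge_pair_def)
qed

text \<open>The modulus bounds the difference of the forms by \<kappa> l |x|^2, and ellipticity at
  \<zeta> turns this additive bound into a relative one.\<close>

lemma Cclass_form_bounds:
  fixes A :: "'n::finite hpt \<Rightarrow> real^('n + 'n)^('n + 'n)"
  assumes C: "Cclass S \<omega> A" and M: "Mclass l L S A" and "0 < l"
    and z: "\<zeta> \<in> S" "z \<in> S" "hdist \<zeta> z < e" "0 < e" "e < 1" "\<omega> e \<le> \<kappa> * l"
  shows "(1 - \<kappa>) * (x \<bullet> (A \<zeta> *v x)) \<le> x \<bullet> (A z *v x)"
    and "x \<bullet> (A z *v x) \<le> (1 + \<kappa>) * (x \<bullet> (A \<zeta> *v x))"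
proof -
  let ?M = "A z - A \<zeta>"
  have on: "onorm (\<lambda>v. ?M *v v) \<le> \<kappa> * l"
  proof -
    have "onorm (\<lambda>v. ?M *v v) \<le> \<omega> e"
      using C z(1-5) unfolding Cclass_def hball_def by auto
    then show ?thesis using z(6) by simp
  qed
  have "\<bar>x \<bullet> (?M *v x)\<bar> \<le> norm x * norm (?M *v x)" by (rule Cauchy_Schwarz_ineq2)
  also have "\<dots> \<le> norm x * (onorm (\<lambda>v. ?M *v v) * norm x)"
    by (intro mult_left_mono onorm matrix_vector_mul_bounded_linear) auto
  also have "\<dots> \<le> norm x * (\<kappa> * l * norm x)"
    by (intro mult_left_mono mult_right_mono on) auto
  also have "\<dots> = \<kappa> * (l * (x \<bullet> x))" by (simp add: power2_eq_square flip: power2_norm_eq_inner)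
  also have "\<dots> \<le> \<kappa> * (x \<bullet> (A \<zeta> *v x))"
  proof (rule mult_left_mono)
    show "l * (x \<bullet> x) \<le> x \<bullet> (A \<zeta> *v x)" using M z(1) by (auto simp: Mclass_def)
    \<comment> \<open>The sign of \<kappa> is not a hypothesis; it follows from 0 <=
      \<open>onorm\<close> <= \<kappa> l.\<close>
    have "0 \<le> onorm (\<lambda>v. ?M *v v)" by (intro onorm_pos_le matrix_vector_mul_bounded_linear)
    then show "0 \<le> \<kappa>" using on \<open>0 < l\<close> by (meson order_trans zero_le_mult_iff less_le_not_le)
  qed
  finally have "\<bar>x \<bullet> (A z *v x) - x \<bullet> (A \<zeta> *v x)\<bar> \<le> \<kappa> * (x \<bullet> (A \<zeta> *v x))"
    by (simp add: matrix_vector_mult_diff_rdistrib inner_diff)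
  then show "(1 - \<kappa>) * (x \<bullet> (A \<zeta> *v x)) \<le> x \<bullet> (A z *v x)"
    and "x \<bullet> (A z *v x) \<le> (1 + \<kappa>) * (x \<bullet> (A \<zeta> *v x))"
    by (simp_all add: algebra_simps abs_le_iff)
qed

subsection \<open>Counting lattice points\<close>

lemma int_interval_count:
  fixes h c \<delta> :: real
  assumes h: "0 < h" and \<delta>: "0 \<le> \<delta>"
  shows "finite {k::int. \<bar>h * k - c\<bar> \<le> \<delta>}"
    and "real (card {k::int. \<bar>h * k - c\<bar> \<le> \<delta>}) \<le> 2 * \<delta> / h + 1"
    and "2 * \<delta> / h - 1 \<le> real (card {k::int. \<bar>h * k - c\<bar> \<le> \<delta>})"
proof -
  have eq: "{k::int. \<bar>h * k - c\<bar> \<le> \<delta>} = {\<lceil>(c - \<delta>) / h\<rceil>..\<lfloor>(c + \<delta>) / h\<rfloor>}"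
    using h by (auto simp: abs_le_iff ceiling_le_iff le_floor_iff field_simps)
  show "finite {k::int. \<bar>h * k - c\<bar> \<le> \<delta>}" unfolding eq by simp
  have len: "(c + \<delta>) / h - (c - \<delta>) / h = 2 * \<delta> / h"
    by (simp add: diff_divide_distrib add_divide_distrib)
  \<comment> \<open>The cardinality of an integer interval is cut off at 0, so the upper bound needs
    a nonnegative length.\<close>
  have "0 \<le> 2 * \<delta> / h" using h \<delta> by simp
  then show "real (card {k::int. \<bar>h * k - c\<bar> \<le> \<delta>}) \<le> 2 * \<delta> / h + 1"
    "2 * \<delta> / h - 1 \<le> real (card {k::int. \<bar>h * k - c\<bar> \<le> \<delta>})"
    unfolding eq card_atLeastAtMost_int len[symmetric] by linarith+
qed

text \<open>The vertical mesh is h^2, following the dilations (x, t) to (h x, h^2 t). A ball of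
  radius \<rho> then holds about (\<rho>/h)^(N+2) points, where N + 2 is the homogeneous
  dimension.\<close>

definition lattice_point :: "real \<Rightarrow> ('n + 'n \<Rightarrow> int) \<times> int \<Rightarrow> 'n::finite hpt" where
  "lattice_point h = (\<lambda>(k, m). (\<chi> i. h * k i, h\<^sup>2 * m))"

lemma inj_lattice_point:
  assumes "0 < h"
  shows "inj (lattice_point h)"
  using assms by (auto simp: inj_on_def lattice_point_def vec_eq_iff fun_eq_iff)

text \<open>For a fixed horizontal index the vertical condition is an interval whose centre depends
  on that index, but whose length does not. So the count is that of a box. The boundary terms +1 are
  absorbed by h <= \<rho>, which costs a factor 3 per factor of the product.\<close>

lemma lattice_count_upper:
  fixes z :: "'n::finite hpt"
  assumes N: "N = CARD('n + 'n)" and h: "0 < h" "h \<le> \<rho>"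
    and H: "H \<subseteq> range (lattice_point h)" "\<And>\<zeta>. \<zeta> \<in> H \<Longrightarrow> hdist z \<zeta> < \<rho>"
  shows "finite H" "real (card H) \<le> 3 ^ (N + 1) * (\<rho> / h) ^ (N + 2)"
proof -
  define S where "S i = {k::int. \<bar>h * k - fst z $ i\<bar> \<le> \<rho>}" for i
  define T where "T k = {m::int. \<bar>h\<^sup>2 * m - (snd z + 2 * ((Jmat *v fst z) \<bullet> (\<chi> i. h * k i)))\<bar> \<le> \<rho>\<^sup>2}" for k :: "'n + 'n \<Rightarrow> int"
  define I where "I = (SIGMA k : PiE UNIV S. T k)"
  have \<rho>: "0 < \<rho>" using h by simp
  have fin: "finite (S i)" "finite (T k)" for i k
    unfolding S_def T_def using h \<rho> by (intro int_interval_count(1); simp)+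
  have sub: "H \<subseteq> lattice_point h ` I"
  proof
    fix \<zeta> assume \<zeta>: "\<zeta> \<in> H"
    then obtain k m where km: "\<zeta> = lattice_point h (k, m)" using H(1) by force
    have "\<bar>h * k i - fst z $ i\<bar> \<le> \<rho>" for i
    proof -
      have "\<bar>h * k i - fst z $ i\<bar> = \<bar>(fst \<zeta> - fst z) $ i\<bar>" by (simp add: km lattice_point_def)
      also have "\<dots> \<le> norm (fst \<zeta> - fst z)" by (rule component_le_norm_cart)
      finally show ?thesis using norm_fst_le_hdist[of \<zeta> z] H(2)[OF \<zeta>] by linarith
    qed
    moreover have "\<bar>hrel z \<zeta>\<bar> \<le> \<rho>\<^sup>2"
      using hrel_le_hdist[of z \<zeta>] power_mono[OF less_imp_le[OF H(2)[OF \<zeta>]], of 2] by simp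
    ultimately have "(k, m) \<in> I"
      by (auto simp: I_def S_def T_def hrel_def km lattice_point_def algebra_simps)
    then show "\<zeta> \<in> lattice_point h ` I" using km by blast
  qed
  have finI: "finite I" unfolding I_def using fin by (intro finite_SigmaI finite_PiE) auto
  then show "finite H" using sub finite_surj by blast
  have r1: "1 \<le> \<rho> / h" using h by simp
  have "real (card H) \<le> real (card I)"
    using surj_card_le[OF finI sub] by simp
  also have "real (card I) = (\<Sum>k\<in>PiE UNIV S. real (card (T k)))"
    unfolding I_def using fin by (subst card_SigmaI) (auto intro: finite_PiE)
  also have "\<dots> \<le> (\<Sum>k\<in>PiE UNIV S. 3 * (\<rho> / h)\<^sup>2)"
  proof (rule sum_mono)
    fix k
    have "real (card (T k)) \<le> 2 * \<rho>\<^sup>2 / h\<^sup>2 + 1"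
      unfolding T_def using h by (intro int_interval_count(2)) auto
    also have "\<dots> \<le> 3 * (\<rho> / h)\<^sup>2" using one_le_power[OF r1, of 2] by (simp add: power_divide)
    finally show "real (card (T k)) \<le> 3 * (\<rho> / h)\<^sup>2" .
  qed
  also have "\<dots> = (\<Prod>i\<in>UNIV. real (card (S i))) * (3 * (\<rho> / h)\<^sup>2)"
    by (simp add: card_PiE)
  also have "\<dots> \<le> (\<Prod>i\<in>(UNIV :: ('n + 'n) set). 3 * (\<rho> / h)) * (3 * (\<rho> / h)\<^sup>2)"
  proof (intro mult_right_mono prod_mono conjI)
    fix i
    have "real (card (S i)) \<le> 2 * \<rho> / h + 1"
      unfolding S_def using h by (intro int_interval_count(2)) auto
    then show "real (card (S i)) \<le> 3 * (\<rho> / h)" using r1 by simp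
  qed auto
  also have "\<dots> = 3 ^ (N + 1) * (\<rho> / h) ^ (N + 2)"
    unfolding prod_constant N[symmetric] power_mult_distrib by (simp add: power_add power2_eq_square)
  finally show "real (card H) \<le> 3 ^ (N + 1) * (\<rho> / h) ^ (N + 2)" .
qed

text \<open>The ball contains a sheared box: horizontal coordinates within \<rho>/(2N) give a norm
  of at most \<rho>/2, vertical ones within \<rho>^2/2, and 1/16 + 1/4 < 1. The mesh is so small
  that losing 1 in each interval count costs at most half of it.\<close>

lemma lattice_count_lower:
  fixes z :: "'n::finite hpt"
  assumes N: "N = CARD('n + 'n)" and h: "0 < h" "2 * real N * h \<le> \<rho>"
  obtains S where "finite S" "S \<subseteq> range (lattice_point h)" "\<And>\<zeta>. \<zeta> \<in> S \<Longrightarrow> hdist z \<zeta> < \<rho>"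
    "(1 / (2 * real N)) ^ N / 2 * (\<rho> / h) ^ (N + 2) \<le> real (card S)"
proof -
  have N1: "1 \<le> real N" 
    using zero_less_card_finite[where 'a = "'n + 'n"] unfolding N[symmetric] by simp
  have \<rho>: "2 * h \<le> \<rho>" "0 < \<rho>"
    using h mult_right_mono[OF N1, of h] by linarith+
  define S where "S i = {k::int. \<bar>h * k - fst z $ i\<bar> \<le> \<rho> / (2 * N)}" for i
  define T where "T k = {m::int. \<bar>h\<^sup>2 * m - (snd z + 2 * ((Jmat *v fst z) \<bullet> (\<chi> i. h * k i)))\<bar> \<le> \<rho>\<^sup>2 / 2}" for k :: "'n + 'n \<Rightarrow> int"
  define I where "I = (SIGMA k : PiE UNIV S. T k)"
  have fin: "finite (S i)" "finite (T k)" for i k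
    unfolding S_def T_def using h \<rho> by (intro int_interval_count(1); simp)+
  have finI: "finite I" unfolding I_def using fin by (intro finite_SigmaI finite_PiE) auto
  have dist: "hdist z (lattice_point h km) < \<rho>" if km: "km \<in> I" for km
  proof -
    obtain k m where [simp]: "km = (k, m)" by force
    define \<zeta> :: "'n hpt" where "\<zeta> = lattice_point h (k, m)"
    have "norm (fst \<zeta> - fst z) \<le> (\<Sum>i\<in>UNIV. \<bar>(fst \<zeta> - fst z) $ i\<bar>)" by (rule norm_le_l1_cart)
    also have "\<dots> \<le> (\<Sum>i\<in>(UNIV :: ('n + 'n) set). \<rho> / (2 * N))"
      using km by (intro sum_mono) (auto simp: \<zeta>_def lattice_point_def I_def S_def PiE_iff)
    also have "\<dots> = \<rho> / 2" using N1 unfolding sum_constant N[symmetric] by simp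
    finally have "norm (fst \<zeta> - fst z) ^ 4 \<le> (\<rho> / 2) ^ 4" by (intro power_mono) auto
    moreover have "\<bar>hrel z \<zeta>\<bar> \<le> \<rho>\<^sup>2 / 2"
      using km by (auto simp: \<zeta>_def lattice_point_def I_def T_def hrel_def algebra_simps)
    then have "\<bar>hrel z \<zeta>\<bar>\<^sup>2 \<le> (\<rho>\<^sup>2 / 2)\<^sup>2" by (intro power_mono) auto
    moreover have "(\<rho> / 2) ^ 4 + (\<rho>\<^sup>2 / 2)\<^sup>2 < \<rho> ^ 4" using \<rho> by (simp add: power_divide)
    ultimately have "norm (fst \<zeta> - fst z) ^ 4 + (hrel z \<zeta>)\<^sup>2 < \<rho> ^ 4"
      unfolding power2_abs by linarith
    then have "hdist z \<zeta> < \<rho>" using \<rho> by (intro hdist_lessI) auto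
    then show ?thesis by (simp add: \<zeta>_def)
  qed
  have "(1 / (2 * real N)) ^ N / 2 * (\<rho> / h) ^ (N + 2)
     = (\<Prod>i\<in>(UNIV :: ('n + 'n) set). \<rho> / (2 * N * h)) * ((\<rho> / h)\<^sup>2 / 2)"
    unfolding prod_constant N[symmetric]
    by (simp add: power_add power_divide power_mult_distrib power2_eq_square ac_simps)
  also have "\<dots> \<le> (\<Prod>i\<in>UNIV. real (card (S i))) * ((\<rho> / h)\<^sup>2 / 2)"
  proof (intro mult_right_mono prod_mono conjI)
    fix i
    have "2 * (\<rho> / (2 * N)) / h - 1 \<le> real (card (S i))"
      unfolding S_def using h \<rho> by (intro int_interval_count(3)) auto
    moreover have "1 \<le> \<rho> / (2 * N * h)" using h N1 by simp
    moreover have "2 * (\<rho> / (2 * N)) / h = 2 * (\<rho> / (2 * N * h))" by simp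
    ultimately show "\<rho> / (2 * N * h) \<le> real (card (S i))" by linarith
  qed (use \<rho> h in auto)
  also have "\<dots> = (\<Sum>k\<in>PiE UNIV S. (\<rho> / h)\<^sup>2 / 2)"
    by (simp add: card_PiE)
  also have "\<dots> \<le> (\<Sum>k\<in>PiE UNIV S. real (card (T k)))"
  proof (rule sum_mono)
    fix k
    have "2 * (\<rho>\<^sup>2 / 2) / h\<^sup>2 - 1 \<le> real (card (T k))"
      unfolding T_def using h by (intro int_interval_count(3)) auto
    moreover have "2 \<le> \<rho> / h" using h \<rho> by (simp add: field_simps)
    then have "2\<^sup>2 \<le> (\<rho> / h)\<^sup>2" by (intro power_mono) auto
    ultimately show "(\<rho> / h)\<^sup>2 / 2 \<le> real (card (T k))" by (simp add: power_divide)
  qed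
  also have "\<dots> = real (card I)"
    unfolding I_def using fin by (subst card_SigmaI) (auto intro: finite_PiE)
  also have "\<dots> = real (card (lattice_point h ` I :: 'n hpt set))"
    using inj_on_subset[OF inj_lattice_point[OF h(1)], of I] by (simp add: card_image)
  finally show thesis using dist finI by (intro that[of "lattice_point h ` I"]) auto
qed

text \<open>Dyadic shells: the one at distance 2^k h has of order 2^(k(N+2)) points, each
  contributing at most (2^k h)^(-(N+1)). The shells thus contribute multiples of 2^k, and their
  geometric sum is 2^k - 1.\<close>

lemma lattice_potential_bound:
  fixes z :: "'n::finite hpt"
  assumes N: "N = CARD('n + 'n)" and h: "0 < h" and H: "H \<subseteq> range (lattice_point h)"
    "\<And>\<zeta>. \<zeta> \<in> H \<Longrightarrow> h \<le> hdist \<zeta> z" "\<And>\<zeta>. \<zeta> \<in> H \<Longrightarrow> hdist \<zeta> z < 2 ^ k * h"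
  shows "(\<Sum>\<zeta>\<in>H. 1 / hdist \<zeta> z ^ (N + 1)) \<le> 3 ^ (N + 1) * 2 ^ (N + 2) * (2 ^ k - 1) / h ^ (N + 1)"
  using H
proof (induction k arbitrary: H)
  case 0
  have "H = {}" using "0.prems"(2,3) by force
  then show ?case by simp
next
  case (Suc k)
  define H1 H2 where "H1 = {\<zeta>\<in>H. hdist \<zeta> z < 2 ^ k * h}" and "H2 = {\<zeta>\<in>H. 2 ^ k * h \<le> hdist \<zeta> z}"
  have le: "h \<le> 2 ^ Suc k * h" 
    using mult_right_mono[OF one_le_power[of "2::real" "Suc k"], of h] h by (simp del: power_Suc)
  have finH: "finite H"
    using lattice_count_upper(1)[OF N h le Suc.prems(1), of z] Suc.prems(3) by (simp add: hdist_commute)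
  have "H2 \<subseteq> H" by (auto simp: H2_def)
  then have card: "real (card H2) \<le> 3 ^ (N + 1) * (2 ^ Suc k) ^ (N + 2)"
    using lattice_count_upper(2)[OF N h le, of H2 z] Suc.prems(1,3) h by (auto simp: hdist_commute)
  have "(\<Sum>\<zeta>\<in>H2. 1 / hdist \<zeta> z ^ (N + 1)) \<le> (\<Sum>\<zeta>\<in>H2. 1 / (2 ^ k * h) ^ (N + 1))"
    using h by (intro sum_mono divide_left_mono power_mono mult_pos_pos zero_less_power) (auto simp: H2_def intro: less_le_trans[rotated])
  also have "\<dots> \<le> 3 ^ (N + 1) * (2 ^ Suc k) ^ (N + 2) * (1 / (2 ^ k * h) ^ (N + 1))"
    unfolding sum_constant by (rule mult_right_mono[OF card]) (use h in simp)
  also have "\<dots> = 3 ^ (N + 1) * 2 ^ (N + 2) * 2 ^ k / h ^ (N + 1)"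
    by (simp add: power_mult_distrib power_add field_simps)
  finally have 2: "(\<Sum>\<zeta>\<in>H2. 1 / hdist \<zeta> z ^ (N + 1)) \<le> 3 ^ (N + 1) * 2 ^ (N + 2) * 2 ^ k / h ^ (N + 1)" .
  have 1: "(\<Sum>\<zeta>\<in>H1. 1 / hdist \<zeta> z ^ (N + 1)) \<le> 3 ^ (N + 1) * 2 ^ (N + 2) * (2 ^ k - 1) / h ^ (N + 1)"
    using Suc.prems by (intro Suc.IH) (auto simp: H1_def)
  have "H = H1 \<union> H2" by (auto simp: H1_def H2_def)
  then have "(\<Sum>\<zeta>\<in>H. 1 / hdist \<zeta> z ^ (N + 1)) = (\<Sum>\<zeta>\<in>H1. 1 / hdist \<zeta> z ^ (N + 1)) + (\<Sum>\<zeta>\<in>H2. 1 / hdist \<zeta> z ^ (N + 1))"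
    using finH by (simp only:) (rule sum.union_disjoint, auto simp: H1_def H2_def)
  also have "\<dots> \<le> 3 ^ (N + 1) * 2 ^ (N + 2) * (2 ^ k - 1) / h ^ (N + 1) + 3 ^ (N + 1) * 2 ^ (N + 2) * 2 ^ k / h ^ (N + 1)"
    using 1 2 by linarith
  also have "\<dots> = 3 ^ (N + 1) * 2 ^ (N + 2) * (2 ^ Suc k - 1) / h ^ (N + 1)"
    by (simp add: algebra_simps diff_divide_distrib add_divide_distrib)
  finally show ?case .
qed

subsection \<open>Lattice potentials\<close>

text \<open>The power of \<open>gphi\<close> is comparable to d^(-(N+1)), that is d^(1-Q). The
  negative exponent exchanges the roles of \<open>l\<close> and \<open>L\<close>.\<close>

lemma gphi_powr_bounds:
  fixes P :: "real^('n::finite + 'n)^('n + 'n)" and N :: nat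
  assumes AP: "gauge_pair A P" and l: "0 < l" "l \<le> 1" "1 \<le> L"
    and A: "\<And>x. l * (x \<bullet> x) \<le> x \<bullet> (A *v x)" "\<And>x. x \<bullet> (A *v x) \<le> L * (x \<bullet> x)"
    and d: "0 < hdist \<zeta> z"
  shows "0 < gphi P \<zeta> z"
    and "L powr (- ((real N + 1) / 2)) / hdist \<zeta> z ^ (N + 1) \<le> gphi P \<zeta> z powr (- ((real N + 1) / 4))"
    and "gphi P \<zeta> z powr (- ((real N + 1) / 4)) \<le> l powr (- ((real N + 1) / 2)) / hdist \<zeta> z ^ (N + 1)"
proof -
  note b = gphi_bounds[OF AP l A, of \<zeta> z]
  have "0 < l\<^sup>2 * hdist \<zeta> z ^ 4" using l d by simp
  then show pos: "0 < gphi P \<zeta> z" using b(1) by linarith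
  have e: "(c\<^sup>2 * hdist \<zeta> z ^ 4) powr (- ((real N + 1) / 4)) = c powr (- ((real N + 1) / 2)) / hdist \<zeta> z ^ (N + 1)"
    if "0 < c" for c
  proof -
    have cd: "c\<^sup>2 * hdist \<zeta> z ^ 4 = c powr 2 * hdist \<zeta> z powr 4"
      using that d powr_realpow[of c 2] powr_realpow[of "hdist \<zeta> z" 4] by simp
    have exps: "2 * - ((real N + 1) / 4) = - ((real N + 1) / 2)" "4 * - ((real N + 1) / 4) = - real (N + 1)"
      by (simp_all add: field_simps)
    have "(c\<^sup>2 * hdist \<zeta> z ^ 4) powr (- ((real N + 1) / 4))
       = c powr (- ((real N + 1) / 2)) * hdist \<zeta> z powr (- real (N + 1))"
      unfolding cd
      by (simp only: powr_mult powr_powr exps)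
    then show ?thesis using d by (simp only: powr_minus_divide powr_realpow) simp
  qed
  show "gphi P \<zeta> z powr (- ((real N + 1) / 4)) \<le> l powr (- ((real N + 1) / 2)) / hdist \<zeta> z ^ (N + 1)"
    unfolding e[OF l(1), symmetric] using b(1) l d by (intro powr_mono2') auto
  have "0 < L" using l by simp
  show "L powr (- ((real N + 1) / 2)) / hdist \<zeta> z ^ (N + 1) \<le> gphi P \<zeta> z powr (- ((real N + 1) / 4))"
    unfolding e[OF \<open>0 < L\<close>, symmetric] using b(2) pos by (intro powr_mono2') auto
qed

lemma continuous_on_gphi_powr:
  assumes "\<And>z. z \<in> S \<Longrightarrow> 0 < gphi P \<zeta> z"
  shows "continuous_on S (\<lambda>z. gphi P \<zeta> z powr c)"
proof -
  have "continuous_on S (gphi P \<zeta>)"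
    unfolding gphi_def
    by (intro continuous_intros bounded_linear.continuous_on[OF matrix_vector_mul_bounded_linear])
  then show ?thesis using assms by (intro continuous_intros) (auto simp: less_imp_neq[symmetric] dest: assms)
qed

lemma line2_norm_sq: "line2 (\<lambda>z. (norm (fst z - x))\<^sup>2) z a (2 * (a \<bullet> a))"
proof -
  define y where "y = fst z - x"
  have "(norm (fst (z + s *\<^sub>R hdir z a) - x))\<^sup>2 = y \<bullet> y + 2 * s * (y \<bullet> a) + s\<^sup>2 * (a \<bullet> a)" for s
  proof -
    have "fst (z + s *\<^sub>R hdir z a) - x = y + s *\<^sub>R a" by (simp add: hdir_def y_def)
    then show ?thesis unfolding power2_norm_eq_inner
      by (simp add: inner_add inner_commute[of a y] power2_eq_square algebra_simps)
  qed
  moreover have "((\<lambda>s. y \<bullet> y + 2 * s * (y \<bullet> a) + s\<^sup>2 * (a \<bullet> a)) has_real_derivative 2 * (y \<bullet> a) + 2 * s * (a \<bullet> a)) (at s)" for s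
    by (auto intro!: derivative_eq_intros)
  moreover have "((\<lambda>s. 2 * (y \<bullet> a) + 2 * s * (a \<bullet> a)) has_real_derivative 2 * (a \<bullet> a)) (at 0)"
    by (auto intro!: derivative_eq_intros)
  ultimately show ?thesis unfolding line2_def
    by (intro exI[of _ "\<lambda>s. 2 * (y \<bullet> a) + 2 * s * (a \<bullet> a)"]) simp
qed

lemma power_of_two_between:
  fixes x :: real
  assumes "1 \<le> x"
  obtains k where "x < 2 ^ k" "2 ^ k \<le> 2 * x"
proof -
  define k where "k = (LEAST k. x < 2 ^ k)"
  have "\<exists>k. x < 2 ^ k" by (rule real_arch_pow) simp
  then have k: "x < 2 ^ k" unfolding k_def by (rule LeastI_ex)
  then have "k \<noteq> 0" using assms by (intro notI) simp
  then obtain j where j: "k = Suc j" by (cases k) auto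
  then have "\<not> x < 2 ^ j" unfolding k_def using not_less_Least[of j "\<lambda>k. x < 2 ^ k"] by simp
  then show thesis using k j by (intro that[of k]) auto
qed

text \<open>All that the rest of the proof uses about the coefficients. The closeness is asked of
  every pair in \<open>U\<close>, because each barrier is frozen at its own centre \<zeta> while the
  operator acts at \<open>z\<close>; the bound on \<kappa> is that of
  \<open>barrier_subsolution\<close>.\<close>

definition nearly_constant ::
  "real \<Rightarrow> real \<Rightarrow> 'n::finite hpt set \<Rightarrow> ('n hpt \<Rightarrow> real^('n + 'n)^('n + 'n)) \<Rightarrow> bool" where
  "nearly_constant l L U A \<longleftrightarrow>
     (\<forall>\<zeta>\<in>U. gauge_pair (A \<zeta>) (matrix_inv (A \<zeta>)) \<and>
        (\<forall>x. l * (x \<bullet> x) \<le> x \<bullet> (A \<zeta> *v x) \<and> x \<bullet> (A \<zeta> *v x) \<le> L * (x \<bullet> x))) \<and>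
     (\<exists>\<kappa>. \<kappa> * (2 * real CARD('n + 'n) + 9) \<le> 1 \<and> (\<forall>\<zeta>\<in>U. \<forall>z\<in>U. \<forall>x.
        (1 - \<kappa>) * (x \<bullet> (A \<zeta> *v x)) \<le> x \<bullet> (A z *v x) \<and> x \<bullet> (A z *v x) \<le> (1 + \<kappa>) * (x \<bullet> (A \<zeta> *v x))))"

lemma nearly_constant_subset:
  "nearly_constant l L U A \<Longrightarrow> V \<subseteq> U \<Longrightarrow> nearly_constant l L V A"
  unfolding nearly_constant_def by blast

text \<open>One decomposition of A(z) into squares serves all barriers at once. Each of them
  contributes a nonnegative amount, and the quadratic term adds 2 \<tau> tr A(z) > 0.\<close>

lemma potential_strict_subsolution:
  fixes A :: "'n::finite hpt \<Rightarrow> real^('n + 'n)^('n + 'n)"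
  assumes l: "0 < l" "l \<le> 1" "1 \<le> L" and A: "nearly_constant l L U A"
    and H: "finite H" "H \<subseteq> U" and z: "z \<in> U" "\<And>\<zeta>. \<zeta> \<in> H \<Longrightarrow> 0 < hdist \<zeta> z"
    and w: "solves A w z" and a: "0 \<le> \<alpha>" and t: "0 < \<tau>"
  obtains b D E where
    "\<And>k. line2 (\<lambda>z. \<alpha> * ((\<Sum>\<zeta>\<in>H. gphi (matrix_inv (A \<zeta>)) \<zeta> z powr (- ((real CARD('n + 'n) + 1) / 4))) - c)
        + \<tau> * ((norm (fst z - x))\<^sup>2 - R)) z (b (k :: 'n + 'n)) (D k)"
    "\<And>k. line2 w z (b k) (E k)" "(\<Sum>k\<in>UNIV. E k) < (\<Sum>k\<in>UNIV. D k)"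
proof -
  let ?g = "\<lambda>\<zeta> z. gphi (matrix_inv (A \<zeta>)) \<zeta> z powr (- ((real CARD('n + 'n) + 1) / 4))"
  obtain \<kappa> where \<kappa>: "\<kappa> * (2 * real CARD('n + 'n) + 9) \<le> 1" and
     form: "\<And>\<zeta> z x. \<zeta> \<in> U \<Longrightarrow> z \<in> U \<Longrightarrow> (1 - \<kappa>) * (x \<bullet> (A \<zeta> *v x)) \<le> x \<bullet> (A z *v x)"
      "\<And>\<zeta> z x. \<zeta> \<in> U \<Longrightarrow> z \<in> U \<Longrightarrow> x \<bullet> (A z *v x) \<le> (1 + \<kappa>) * (x \<bullet> (A \<zeta> *v x))"
    using A unfolding nearly_constant_def by blast
  have gp: "gauge_pair (A \<zeta>) (matrix_inv (A \<zeta>))" if "\<zeta> \<in> U" for \<zeta>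
    using A that unfolding nearly_constant_def by blast
  have ell: "l * (x \<bullet> x) \<le> x \<bullet> (A \<zeta> *v x)" "x \<bullet> (A \<zeta> *v x) \<le> L * (x \<bullet> x)" if "\<zeta> \<in> U" for \<zeta> x
    using A that unfolding nearly_constant_def by blast+
  have psd: "0 \<le> x \<bullet> (A \<zeta> *v x)" if "\<zeta> \<in> U" for \<zeta> x
    using ell(1)[OF that, of x] l by (meson inner_ge_zero less_imp_le mult_nonneg_nonneg order_trans)
  have "transpose (A z) = A z" using gp[OF z(1)] by (simp add: gauge_pair_def)
  then obtain b :: "'n + 'n \<Rightarrow> real^('n + 'n)" where b: "\<And>i j. A z $ i $ j = (\<Sum>k\<in>UNIV. b k $ i * b k $ j)"
    using psd_sum_squares psd[OF z(1)] by blast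
  obtain E where E: "\<And>k. line2 w z (b k) (E k)" "(\<Sum>k\<in>UNIV. E k) = 0"
    using w b unfolding solves_def by blast
  have "\<exists>D. (\<forall>k. line2 (?g \<zeta>) z (b k) (D k)) \<and> 0 \<le> (\<Sum>k\<in>UNIV. D k)" if "\<zeta> \<in> H" for \<zeta>
  proof -
    have \<zeta>: "\<zeta> \<in> U" using that H by blast
    have "0 < gphi (matrix_inv (A \<zeta>)) \<zeta> z"
      using gphi_powr_bounds(1)[OF gp[OF \<zeta>] l ell[OF \<zeta>] z(2)[OF that]] .
    from barrier_subsolution[OF gp[OF \<zeta>] psd[OF \<zeta>] form[OF \<zeta> z(1)] b \<kappa> this]
    show ?thesis by metis
  qed
  then obtain D where D: "\<And>\<zeta> k. \<zeta> \<in> H \<Longrightarrow> line2 (?g \<zeta>) z (b k) (D \<zeta> k)"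
      "\<And>\<zeta>. \<zeta> \<in> H \<Longrightarrow> 0 \<le> (\<Sum>k\<in>UNIV. D \<zeta> k)" by metis
  define D' where "D' k = \<alpha> * ((\<Sum>\<zeta>\<in>H. D \<zeta> k) - 0) + \<tau> * (2 * (b k \<bullet> b k) - 0)" for k
  \<comment> \<open>This is the trace of A(z). If it were 0, all b_k would vanish and so would A(z),
    against ellipticity in any unit direction.\<close>
  have "0 < (\<Sum>k\<in>UNIV. b k \<bullet> b k)"
  proof (rule ccontr)
    assume "\<not> ?thesis"
    then have "(\<Sum>k\<in>UNIV. b k \<bullet> b k) = 0" by (intro antisym sum_nonneg) auto
    then have "\<And>k. b k = 0" by (subst (asm) sum_nonneg_eq_0_iff) auto
    then have "x \<bullet> (A z *v x) = 0" for x by (simp add: inner_matrix_sum_squares[OF b])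
    then show False using ell(1)[OF z(1), of "axis undefined 1"] l by (simp add: inner_axis)
  qed
  moreover have "(\<Sum>k\<in>UNIV. \<Sum>\<zeta>\<in>H. D \<zeta> k) = (\<Sum>\<zeta>\<in>H. \<Sum>k\<in>UNIV. D \<zeta> k)" by (rule sum.swap)
  then have "0 \<le> (\<Sum>k\<in>UNIV. \<Sum>\<zeta>\<in>H. D \<zeta> k)" using D(2) by (simp add: sum_nonneg)
  moreover have "(\<Sum>k\<in>UNIV. D' k) = \<alpha> * (\<Sum>k\<in>UNIV. \<Sum>\<zeta>\<in>H. D \<zeta> k) + \<tau> * (2 * (\<Sum>k\<in>UNIV. b k \<bullet> b k))"
    by (simp add: D'_def sum.distrib sum_distrib_left)
  ultimately have "0 < (\<Sum>k\<in>UNIV. D' k)" using a t by (simp add: add_nonneg_pos)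
  moreover have "line2 (\<lambda>z. \<alpha> * ((\<Sum>\<zeta>\<in>H. ?g \<zeta> z) - c) + \<tau> * ((norm (fst z - x))\<^sup>2 - R)) z (b k) (D' k)" for k
    unfolding D'_def
    by (intro line2_add line2_cmult line2_diff line2_const line2_norm_sq line2_sum H(1) D(1))
  ultimately show thesis using E by (intro that[of b D' E]) auto
qed

text \<open>The solution is compared with (T/B) (F - M/2), where \<open>F\<close> is the sum of the
  barriers centred at \<open>H\<close>. \<open>B\<close> bounds \<open>F\<close> at distance at
  least h from \<open>H\<close>, \<open>M/2\<close> bounds it on the outer sphere, and
  \<open>F\<close> is at least \<open>M\<close> in the inner ball. So w >= T M / (2 B) there, and
  M/B is a constant times \<open>card H * (h / \<rho>) ^ (N + 2)\<close>, the density of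
  \<open>H\<close>. The first entry of the minimum is for points within h of
  \<open>H\<close>.\<close>

lemma growth_estimate:
  fixes A :: "'n::finite hpt \<Rightarrow> real^('n + 'n)^('n + 'n)" and N :: nat
  defines "N \<equiv> CARD('n + 'n)"
  assumes l: "0 < l" "l \<le> 1" "1 \<le> L"
  defines "c1 \<equiv> L powr (- ((real N + 1) / 2))" and "c2 \<equiv> l powr (- ((real N + 1) / 2))"
  assumes K: "K = 1 + 4 * c2 / c1"
    and h: "0 < h" "h \<le> \<rho>" and A: "nearly_constant l L {z. hdist z1 z < K * \<rho>} A"
    and w: "continuous_on {z. hdist z1 z \<le> K * \<rho>} w"
      "\<And>z. hdist z1 z \<le> K * \<rho> \<Longrightarrow> 0 \<le> w z" "\<And>z. hdist z1 z < K * \<rho> \<Longrightarrow> solves A w z"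
    and H: "H \<subseteq> range (lattice_point h)" "\<And>\<zeta>. \<zeta> \<in> H \<Longrightarrow> hdist z1 \<zeta> < \<rho>"
    and T: "0 < T" "\<And>\<zeta> z. \<zeta> \<in> H \<Longrightarrow> hdist \<zeta> z \<le> h \<Longrightarrow> T \<le> w z"
    and z: "hdist z1 z < \<rho>"
  shows "T * min (1 / 3 ^ (N + 1)) (c1 / (c2 * 3 ^ (N + 1) * 2 ^ (2 * N + 5) * (K + 1))) * card H * (h / \<rho>) ^ (N + 2) \<le> w z"
proof -
  define P where "P \<zeta> = matrix_inv (A \<zeta>)" for \<zeta>
  define F where "F z = (\<Sum>\<zeta>\<in>H. gphi (P \<zeta>) \<zeta> z powr (- ((real N + 1) / 4)))" for z
  \<comment> \<open>The domain of comparison: the large closed ball without the h-balls around the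
    points of \<open>H\<close>, where the barriers are singular.\<close>
  define G where "G = {z. hdist z1 z \<le> K * \<rho>} \<inter> (\<Inter>\<zeta>\<in>H. {z. h \<le> hdist \<zeta> z})"
  have \<rho>: "0 < \<rho>" using h by simp
  have c1: "0 < c1" "c1 \<le> 1" and c2: "1 \<le> c2"
    using l ge_one_powr_ge_zero[of L "(real N + 1) / 2"] powr_le1[of "(real N + 1) / 2" l]
    by (auto simp: c1_def c2_def powr_minus_divide)
  have "1 \<le> c2 / c1" using c1 c2 by simp
  then have K5: "5 \<le> K" by (simp add: K)
  have K\<rho>: "2 * \<rho> < K * \<rho>" "\<rho> \<le> K * \<rho>" using K5 \<rho> by (auto simp: mult_le_cancel_right2)
  have finH: "finite H" and cardH: "real (card H) \<le> 3 ^ (N + 1) * (\<rho> / h) ^ (N + 2)"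
    using lattice_count_upper[OF N_def[THEN meta_eq_to_obj_eq] h H] by auto
  have HU: "H \<subseteq> {z. hdist z1 z < K * \<rho>}" using H(2) K\<rho> by force
  have comp: "compact G"
    unfolding G_def by (intro compact_Int_closed compact_hcball closed_INT ballI closed_hcball)
  have gb: "c1 / hdist \<zeta> z ^ (N + 1) \<le> gphi (P \<zeta>) \<zeta> z powr (- ((real N + 1) / 4))"
      "gphi (P \<zeta>) \<zeta> z powr (- ((real N + 1) / 4)) \<le> c2 / hdist \<zeta> z ^ (N + 1)"
      "0 < gphi (P \<zeta>) \<zeta> z"
    if "\<zeta> \<in> H" "0 < hdist \<zeta> z" for \<zeta> z
  proof -
    have *: "gauge_pair (A \<zeta>) (P \<zeta>)" "\<And>x. l * (x \<bullet> x) \<le> x \<bullet> (A \<zeta> *v x)" "\<And>x. x \<bullet> (A \<zeta> *v x) \<le> L * (x \<bullet> x)"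
      using A HU that(1) unfolding nearly_constant_def P_def by blast+
    show "c1 / hdist \<zeta> z ^ (N + 1) \<le> gphi (P \<zeta>) \<zeta> z powr (- ((real N + 1) / 4))"
      "gphi (P \<zeta>) \<zeta> z powr (- ((real N + 1) / 4)) \<le> c2 / hdist \<zeta> z ^ (N + 1)"
      "0 < gphi (P \<zeta>) \<zeta> z"
      unfolding c1_def c2_def by (rule gphi_powr_bounds[OF *(1) l *(2,3) that(2)])+
  qed
  have posG: "0 < hdist \<zeta> z" if "\<zeta> \<in> H" "z \<in> G" for \<zeta> z
    using that h(1) by (force simp: G_def)
  have contF: "continuous_on G F"
    unfolding F_def by (intro continuous_on_sum continuous_on_gphi_powr gb(3) posG)
  \<comment> \<open>\<open>B\<close> is the potential bound with 2^k at most 2 (K+1) \<rho>/h, as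
    \<open>H\<close> lies within (K+1) \<rho> of any point of \<open>G\<close>. \<open>M\<close>
    uses that two points of the inner ball are less than 2 \<rho> apart.\<close>
  define B where "B = c2 * 3 ^ (N + 1) * 2 ^ (N + 2) * (2 * (K + 1) * (\<rho> / h)) / h ^ (N + 1)"
  define M where "M = c1 * card H / (2 * \<rho>) ^ (N + 1)"
  have B: "0 < B" unfolding B_def using c2 h \<rho> K5 by (intro divide_pos_pos mult_pos_pos) auto
  have M: "0 \<le> M" unfolding M_def using c1 \<rho> by simp
  have F_le: "F z \<le> B" if "z \<in> G" for z
  proof -
    have "1 \<le> \<rho> / h" using h by simp
    then have "1 \<le> (K + 1) * (\<rho> / h)" using K5 mult_mono[of 1 "K + 1" 1 "\<rho> / h"] by simp
    then obtain k where k: "(K + 1) * (\<rho> / h) < 2 ^ k" "2 ^ k \<le> 2 * ((K + 1) * (\<rho> / h))"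
      by (rule power_of_two_between)
    have far: "hdist \<zeta> z < 2 ^ k * h" if "\<zeta> \<in> H" for \<zeta>
    proof -
      have "hdist \<zeta> z \<le> hdist \<zeta> z1 + hdist z1 z" by (rule hdist_triangle)
      also have "\<dots> \<le> \<rho> + K * \<rho>"
        using H(2)[OF that] \<open>z \<in> G\<close> by (intro add_mono) (auto simp: hdist_commute G_def)
      also have "\<dots> = (K + 1) * (\<rho> / h) * h"
      proof -
        have "\<rho> / h * h = \<rho>" using h(1) by simp
        then show ?thesis by (simp only: mult.assoc) (simp add: algebra_simps)
      qed
      also have "\<dots> < 2 ^ k * h" by (rule mult_strict_right_mono[OF k(1) h(1)])
      finally show ?thesis .
    qed
    have "F z \<le> (\<Sum>\<zeta>\<in>H. c2 * (1 / hdist \<zeta> z ^ (N + 1)))"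
      unfolding F_def using gb(2) posG[OF _ that] by (intro sum_mono) simp
    also have "\<dots> = c2 * (\<Sum>\<zeta>\<in>H. 1 / hdist \<zeta> z ^ (N + 1))" by (rule sum_distrib_left[symmetric])
    also have "\<dots> \<le> c2 * (3 ^ (N + 1) * 2 ^ (N + 2) * (2 ^ k - 1) / h ^ (N + 1))"
      using c2 that far by (intro mult_left_mono lattice_potential_bound[OF N_def[THEN meta_eq_to_obj_eq] h(1) H(1)]) (auto simp: G_def)
    also have "\<dots> \<le> c2 * (3 ^ (N + 1) * 2 ^ (N + 2) * (2 * ((K + 1) * (\<rho> / h))) / h ^ (N + 1))"
      using c2 k h by (intro mult_left_mono divide_right_mono) auto
    also have "\<dots> = B" by (simp add: B_def)
    finally show ?thesis .
  qed
  have F_far: "F z \<le> M / 2" if "hdist z1 z = K * \<rho>" "z \<in> G" for z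
  proof -
    \<comment> \<open>\<open>K\<close> is chosen so that the outer sphere has distance at least X (2
      \<rho>) from \<open>H\<close>. Since X >= 1, one of the N + 1 factors X is enough to make each
      barrier at most half of its lower bound in the inner ball.\<close>
    define X where "X = 2 * c2 / c1"
    have X: "1 \<le> X" using \<open>1 \<le> c2 / c1\<close> by (simp add: X_def)
    have KX: "K - 1 = 2 * X" by (simp add: K X_def)
    have "gphi (P \<zeta>) \<zeta> z powr (- ((real N + 1) / 4)) \<le> c1 / (2 * \<rho>) ^ (N + 1) / 2" if \<zeta>: "\<zeta> \<in> H" for \<zeta>
    proof -
      have "K * \<rho> \<le> hdist z1 \<zeta> + hdist \<zeta> z" using hdist_triangle[of z1 z \<zeta>] that \<open>hdist z1 z = _\<close> by simp
      then have "(K - 1) * \<rho> \<le> hdist \<zeta> z" using H(2)[OF \<zeta>] by (simp add: algebra_simps)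
      then have d: "X * (2 * \<rho>) \<le> hdist \<zeta> z" by (simp add: KX algebra_simps)
      have "X * (2 * \<rho>) ^ (N + 1) \<le> X ^ (N + 1) * (2 * \<rho>) ^ (N + 1)"
        using X \<rho> by (intro mult_right_mono self_le_power) auto
      also have "\<dots> = (X * (2 * \<rho>)) ^ (N + 1)" by (rule power_mult_distrib[symmetric])
      also have "\<dots> \<le> hdist \<zeta> z ^ (N + 1)" using d X \<rho> by (intro power_mono) auto
      finally have d2: "X * (2 * \<rho>) ^ (N + 1) \<le> hdist \<zeta> z ^ (N + 1)" .
      have "gphi (P \<zeta>) \<zeta> z powr (- ((real N + 1) / 4)) \<le> c2 / hdist \<zeta> z ^ (N + 1)"
        using gb(2)[OF \<zeta> posG[OF \<zeta> \<open>z \<in> G\<close>]] .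
      also have "\<dots> \<le> c2 / (X * (2 * \<rho>) ^ (N + 1))"
        using d2 c2 X \<rho> by (intro divide_left_mono mult_pos_pos zero_less_power posG[OF \<zeta> \<open>z \<in> G\<close>]) auto
      also have "\<dots> = c1 / (2 * \<rho>) ^ (N + 1) / 2" using c1 c2 by (simp add: X_def)
      finally show ?thesis .
    qed
    then have "F z \<le> (\<Sum>\<zeta>\<in>H. c1 / (2 * \<rho>) ^ (N + 1) / 2)" unfolding F_def by (rule sum_mono)
    also have "\<dots> = M / 2" by (simp add: M_def)
    finally show ?thesis .
  qed
  have F_near: "M \<le> F z" if "hdist z1 z < \<rho>" "z \<in> G" for z
  proof -
    have "c1 / (2 * \<rho>) ^ (N + 1) \<le> gphi (P \<zeta>) \<zeta> z powr (- ((real N + 1) / 4))" if \<zeta>: "\<zeta> \<in> H" for \<zeta>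
    proof -
      have "hdist \<zeta> z \<le> 2 * \<rho>"
        using hdist_triangle[of \<zeta> z z1] H(2)[OF \<zeta>] \<open>hdist z1 z < \<rho>\<close> by (simp add: hdist_commute)
      then have "hdist \<zeta> z ^ (N + 1) \<le> (2 * \<rho>) ^ (N + 1)" by (intro power_mono) auto
      then have "c1 / (2 * \<rho>) ^ (N + 1) \<le> c1 / hdist \<zeta> z ^ (N + 1)"
        using c1 \<rho> by (intro divide_left_mono mult_pos_pos zero_less_power posG[OF \<zeta> \<open>z \<in> G\<close>]) auto
      also have "\<dots> \<le> gphi (P \<zeta>) \<zeta> z powr (- ((real N + 1) / 4))"
        using gb(1)[OF \<zeta> posG[OF \<zeta> \<open>z \<in> G\<close>]] .
      finally show ?thesis .
    qed
    then have "(\<Sum>\<zeta>\<in>H. c1 / (2 * \<rho>) ^ (N + 1)) \<le> F z" unfolding F_def by (rule sum_mono)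
    then show ?thesis by (simp add: M_def mult.commute)
  qed
  \<comment> \<open>The quadratic term makes the subsolution strict, since the barriers degenerate over their centres.\<close>
  have below: "T / B * (F z - M / 2) + \<tau> * ((norm (fst z - fst z1))\<^sup>2 - (K * \<rho>)\<^sup>2) \<le> w z"
    if \<tau>: "0 < \<tau>" and zG: "z \<in> G" for z \<tau>
  proof (rule comparison[OF comp _ _ _ zG])
    show "continuous_on G (\<lambda>z. T / B * (F z - M / 2) + \<tau> * ((norm (fst z - fst z1))\<^sup>2 - (K * \<rho>)\<^sup>2))"
      by (intro continuous_intros contF)
    show "continuous_on G w" using w(1) by (rule continuous_on_subset) (auto simp: G_def)
  next
    fix z assume zG: "z \<in> G"
    let ?v = "\<lambda>z. T / B * (F z - M / 2) + \<tau> * ((norm (fst z - fst z1))\<^sup>2 - (K * \<rho>)\<^sup>2)"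
    have dK: "hdist z1 z \<le> K * \<rho>" using zG by (simp add: G_def)
    have "norm (fst z - fst z1) \<le> K * \<rho>" using norm_fst_le_hdist[of z z1] dK by simp
    then have "(norm (fst z - fst z1))\<^sup>2 - (K * \<rho>)\<^sup>2 \<le> 0" by (simp add: power_mono)
    then have quad: "\<tau> * ((norm (fst z - fst z1))\<^sup>2 - (K * \<rho>)\<^sup>2) \<le> 0" using \<tau> by (simp add: mult_le_0_iff)
    \<comment> \<open>The outer sphere, where the comparison function is at most 0; a sphere of
      radius h about a point of \<open>H\<close>, where it is at most \<open>T\<close>; and the
      interior, where it is a strict subsolution.\<close>
    consider "hdist z1 z = K * \<rho>" | \<zeta> where "\<zeta> \<in> H" "hdist \<zeta> z = h"
      | "hdist z1 z < K * \<rho>" "\<And>\<zeta>. \<zeta> \<in> H \<Longrightarrow> h < hdist \<zeta> z"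
      using zG by (force simp: G_def)
    then show "?v z \<le> w z \<or> (\<exists>U. open U \<and> z \<in> U \<and> U \<subseteq> G \<and>
       (\<exists>(b :: 'n + 'n \<Rightarrow> real^('n + 'n)) D E. (\<forall>k. line2 ?v z (b k) (D k)) \<and> (\<forall>k. line2 w z (b k) (E k))
           \<and> (\<Sum>k\<in>UNIV. E k) < (\<Sum>k\<in>UNIV. D k)))"
    proof cases
      case 1
      have "T / B * (F z - M / 2) \<le> 0"
        using F_far[OF 1 zG] T(1) B by (intro mult_nonneg_nonpos) auto
      then show ?thesis using quad w(2)[OF dK] by linarith
    next
      case 2
      have "T / B * (F z - M / 2) \<le> T / B * B"
        using F_le[OF zG] M T(1) B by (intro mult_left_mono) auto
      also have "\<dots> = T" using B by simp
      also have "T \<le> w z" using T(2)[OF 2(1)] 2(2) by simp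
      finally show ?thesis using quad by linarith
    next
      case 3
      define U where "U = {z. hdist z1 z < K * \<rho>} \<inter> (\<Inter>\<zeta>\<in>H. {z. h < hdist \<zeta> z})"
      have "open U" unfolding U_def by (intro open_Int open_INT finH ballI open_hball_set)
      moreover have "z \<in> U" "U \<subseteq> G" using 3 by (auto simp: U_def G_def less_imp_le)
      moreover have zU: "z \<in> {z. hdist z1 z < K * \<rho>}" using 3 by simp
      have "\<exists>b D E. (\<forall>k. line2 ?v z (b k) (D k)) \<and> (\<forall>k. line2 w z (b k) (E k))
           \<and> (\<Sum>k\<in>UNIV. E k) < (\<Sum>k\<in>(UNIV :: ('n + 'n) set). D k)"
      proof (rule potential_strict_subsolution[OF l A finH HU zU posG[OF _ zG] w(3)[OF 3(1)] _ \<tau>,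
            where \<alpha> = "T / B" and c = "M / 2" and x = "fst z1" and R = "(K * \<rho>)\<^sup>2"])
        show "0 \<le> T / B" using T(1) B by simp
      next
        fix b :: "'n + 'n \<Rightarrow> real^('n + 'n)" and D E
        assume "\<And>k. line2 (\<lambda>z. T / B * ((\<Sum>\<zeta>\<in>H. gphi (matrix_inv (A \<zeta>)) \<zeta> z powr
            - ((real CARD('n + 'n) + 1) / 4)) - M / 2) + \<tau> * ((norm (fst z - fst z1))\<^sup>2 - (K * \<rho>)\<^sup>2)) z (b k) (D k)"
          "\<And>k. line2 w z (b k) (E k)" "sum E UNIV < sum D UNIV"
        then show ?thesis unfolding F_def P_def N_def by blast
      qed
      ultimately show ?thesis by blast
    qed
  qed
  define C where "C = c1 / (c2 * 3 ^ (N + 1) * 2 ^ (2 * N + 5) * (K + 1))"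
  have main: "T * C * card H * (h / \<rho>) ^ (N + 2) \<le> w z" if zG: "z \<in> G"
  proof -
    have "T / B * (M / 2) - \<tau> * (K * \<rho>)\<^sup>2 \<le> w z" if \<tau>: "0 < \<tau>" for \<tau>
    proof -
      have "T / B * (M / 2) \<le> T / B * (F z - M / 2)"
        using F_near[OF z zG] T(1) B by (intro mult_left_mono) auto
      moreover have "\<tau> * (- (K * \<rho>)\<^sup>2) \<le> \<tau> * ((norm (fst z - fst z1))\<^sup>2 - (K * \<rho>)\<^sup>2)"
        using \<tau> by (intro mult_left_mono) auto
      ultimately show ?thesis using below[OF \<tau> zG] by simp
    qed
    \<comment> \<open>Let \<tau> tend to 0, with \<tau> = e / (K \<rho>)^2.\<close>
    then have step: "T / B * (M / 2) \<le> w z + e" if "0 < e" for e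
    proof -
      have "0 < (K * \<rho>)\<^sup>2" using K5 \<rho> by simp
      moreover have "T / B * (M / 2) - (e / (K * \<rho>)\<^sup>2) * (K * \<rho>)\<^sup>2 \<le> w z"
        using that calculation by (intro \<open>\<And>\<tau>. 0 < \<tau> \<Longrightarrow> _\<close>) simp
      ultimately show ?thesis by simp
    qed
    have "T / B * (M / 2) \<le> w z" by (rule field_le_epsilon) (rule step)
    moreover have "T / B * (M / 2) = T * C * card H * (h / \<rho>) ^ (N + 2)"
    proof -
      \<comment> \<open>The powers are replaced by opaque nonzero reals, so that the identity
        becomes one of rational functions.\<close>
      have alg: "T / (c2 * a * b * (2 * D * (\<rho> / h)) / g) * (c1 * n / (e * p) / 2)
          = T * (c1 / (c2 * a * (e * b * 4) * D)) * n * ((h * g) / (\<rho> * p))"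
        if "a \<noteq> 0" "b \<noteq> 0" "D \<noteq> 0" "g \<noteq> 0" "e \<noteq> 0" "p \<noteq> 0" for a b D g e p n :: real
        using that h \<rho> c2 by (simp add: field_simps)
      have two: "(2::real) ^ (2 * N + 5) = 2 ^ (N + 1) * 2 ^ (N + 2) * 4"
      proof -
        have "2 * N + 5 = (N + 1) + (N + 2) + 2" by simp
        then show ?thesis by (simp only: power_add) simp
      qed
      have "(h / \<rho>) ^ (N + 2) = (h * h ^ (N + 1)) / (\<rho> * \<rho> ^ (N + 1))"
        by (simp add: power_divide)
      then show ?thesis
        unfolding B_def M_def C_def two power_mult_distrib[of 2 \<rho>]
        using alg[of "3 ^ (N + 1)" "2 ^ (N + 2)" "K + 1" "h ^ (N + 1)" "2 ^ (N + 1)" "\<rho> ^ (N + 1)" "real (card H)"]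
          h \<rho> K5 by (simp only:) simp
    qed
    ultimately show ?thesis by simp
  qed
  have C: "0 < C" using c1 c2 K5 by (simp add: C_def)
  show ?thesis
  proof (cases "z \<in> G")
    case True
    have "T * min (1 / 3 ^ (N + 1)) C * card H * (h / \<rho>) ^ (N + 2) \<le> T * C * card H * (h / \<rho>) ^ (N + 2)"
      using T(1) h \<rho> by (intro mult_right_mono mult_left_mono) auto
    then show ?thesis using main[OF True] unfolding C_def by linarith
  next
    case False
    \<comment> \<open>A point of the inner ball outside \<open>G\<close> is within h of
      \<open>H\<close>, so w >= T there; the upper count of \<open>H\<close> shows that the claimed
      bound does not exceed \<open>T\<close>.\<close>
    then obtain \<zeta> where "\<zeta> \<in> H" "hdist \<zeta> z \<le> h" using z K\<rho> by (force simp: G_def)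
    then have "T \<le> w z" by (rule T(2))
    have "T * min (1 / 3 ^ (N + 1)) C * card H * (h / \<rho>) ^ (N + 2) \<le> T * (1 / 3 ^ (N + 1)) * (3 ^ (N + 1) * (\<rho> / h) ^ (N + 2)) * (h / \<rho>) ^ (N + 2)"
      using T(1) h \<rho> cardH C by (intro mult_right_mono mult_mono) auto
    also have "\<dots> = T" using h \<rho> by (simp add: power_divide)
    finally show ?thesis using \<open>T \<le> w z\<close> unfolding C_def by linarith
  qed
qed

subsection \<open>The Harnack inequality\<close>

text \<open>Compactness gives uniform continuity for the Euclidean distance, which is at most d (1 +
  d + 2 |x|) for gauge distance d and horizontal part x of \<zeta>. The number \<open>B\<close>
  bounds the bracket for d <= 1.\<close>

lemma uniformly_continuous_hdist:
  assumes u: "continuous_on {z. hdist z0 z \<le> R} u" and R: "R0 < R" and e: "0 < e"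
  obtains h where "0 < h" "\<And>\<zeta> z. hdist z0 \<zeta> \<le> R0 \<Longrightarrow> hdist \<zeta> z \<le> h \<Longrightarrow> \<bar>u \<zeta> - u z :: real\<bar> < e"
proof -
  have "uniformly_continuous_on {z. hdist z0 z \<le> R} u"
    using u compact_hcball by (rule compact_uniformly_continuous)
  then obtain \<delta> where \<delta>: "0 < \<delta>"
    "\<And>\<zeta> z. hdist z0 \<zeta> \<le> R \<Longrightarrow> hdist z0 z \<le> R \<Longrightarrow> dist z \<zeta> < \<delta> \<Longrightarrow> dist (u z) (u \<zeta>) < e"
    unfolding uniformly_continuous_on_def using e by (metis mem_Collect_eq)
  define B where "B = 2 + 2 * (norm (fst z0) + \<bar>R0\<bar>)"
  have B: "2 \<le> B" by (simp add: B_def)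
  define h where "h = min 1 (min (R - R0) (\<delta> / (2 * B)))"
  have h: "0 < h" "h \<le> 1" "h \<le> R - R0" using R \<delta>(1) B by (auto simp: h_def)
  have "h \<le> \<delta> / (2 * B)" by (simp add: h_def)
  then have hB: "h * B < \<delta>" using B \<delta>(1) by (simp add: pos_le_divide_eq)
  show thesis
  proof (rule that[OF h(1)])
    fix \<zeta> z assume \<zeta>: "hdist z0 \<zeta> \<le> R0" and z: "hdist \<zeta> z \<le> h"
    have "hdist z0 z \<le> R" using hdist_triangle[of z0 z \<zeta>] \<zeta> z h by linarith
    moreover have "hdist z0 \<zeta> \<le> R" using \<zeta> R by simp
    moreover have "dist z \<zeta> < \<delta>"
    proof -
      have n: "norm (fst \<zeta>) \<le> norm (fst z0) + \<bar>R0\<bar>"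
        using norm_triangle_ineq[of "fst z0" "fst \<zeta> - fst z0"] norm_fst_le_hdist[of \<zeta> z0] \<zeta> by simp
      have "dist z \<zeta> \<le> norm (fst z - fst \<zeta>) + \<bar>snd z - snd \<zeta>\<bar>"
        unfolding dist_prod_def dist_norm real_norm_def[symmetric] by (rule sqrt_sum_squares_le_sum) auto
      also have "\<dots> \<le> hdist \<zeta> z + ((hdist \<zeta> z)\<^sup>2 + 2 * norm (fst \<zeta>) * hdist \<zeta> z)"
        by (intro add_mono norm_fst_le_hdist norm_snd_le_hdist)
      also have "\<dots> = hdist \<zeta> z * (1 + hdist \<zeta> z + 2 * norm (fst \<zeta>))"
        by (simp add: algebra_simps power2_eq_square)
      also have "\<dots> \<le> h * B"
        using z h n by (intro mult_mono) (auto simp: B_def)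
      finally show ?thesis using hB by simp
    qed
    ultimately have "dist (u z) (u \<zeta>) < e" by (intro \<delta>(2))
    then show "\<bar>u \<zeta> - u z\<bar> < e" by (simp add: dist_real_def abs_minus_commute)
  qed
qed

text \<open>The growth lemma is an assumption quantified over solution, centre and radius, since it
  is applied to \<open>u\<close> on the large ball and to (1 + \<theta>) M - u on a small ball about
  another centre.\<close>

lemma harnack_of_growth:
  fixes A :: "'n::finite hpt \<Rightarrow> real^('n + 'n)^('n + 'n)" and N :: nat
  assumes N: "N = CARD('n + 'n)"
    and growth: "\<And>w z1 \<rho> h H T z. 0 < h \<Longrightarrow> h \<le> \<rho> \<Longrightarrow> nearly_constant l L {z. hdist z1 z < K * \<rho>} A \<Longrightarrow>
      continuous_on {z. hdist z1 z \<le> K * \<rho>} w \<Longrightarrow> (\<And>z. hdist z1 z \<le> K * \<rho> \<Longrightarrow> 0 \<le> w z) \<Longrightarrow>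
      (\<And>z. hdist z1 z < K * \<rho> \<Longrightarrow> solves A w z) \<Longrightarrow> H \<subseteq> range (lattice_point h) \<Longrightarrow>
      (\<And>\<zeta>. \<zeta> \<in> H \<Longrightarrow> hdist z1 \<zeta> < \<rho>) \<Longrightarrow> 0 < T \<Longrightarrow>
      (\<And>\<zeta> z. \<zeta> \<in> H \<Longrightarrow> hdist \<zeta> z \<le> h \<Longrightarrow> T \<le> w z) \<Longrightarrow> hdist z1 z < \<rho> \<Longrightarrow>
      T * c0 * card H * (h / \<rho>) ^ (N + 2) \<le> w z"
    and c0: "0 < c0" "c0 \<le> 1" and K: "5 \<le> K"
    and A: "nearly_constant l L {z. hdist z0 z < K * (2 * r)} A" and r: "0 < r"
    and u: "continuous_on {z. hdist z0 z \<le> K * (2 * r)} u"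
      "\<And>z. hdist z0 z \<le> K * (2 * r) \<Longrightarrow> 0 \<le> u z" "\<And>z. hdist z0 z < K * (2 * r) \<Longrightarrow> solves A u z"
    and z: "hdist z0 za < r" "hdist z0 zb < r"
  defines "c3 \<equiv> (1 / (2 * real N)) ^ N / 2"
  defines "\<theta> \<equiv> c0 * c3 / 16"
  shows "c0 * c3 / 8 * (\<theta> / (2 * (real N + 2)) / (2 * K)) ^ (N + 2) * u za \<le> u zb"
proof -
  define Q where "Q = N + 2"
  \<comment> \<open>Bernoulli's inequality then gives (1 - \<sigma>)^Q >= 1 - \<theta>/2, so that (1
    + \<theta>) (1 - \<sigma>)^Q >= 1.\<close>
  define \<sigma> where "\<sigma> = \<theta> / (2 * real Q)"
  have N1: "1 \<le> real N" using zero_less_card_finite[where 'a = "'n + 'n"] unfolding N[symmetric] by simp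
  have "(1 / (2 * real N)) ^ N \<le> 1" using N1 by (intro power_le_one) auto
  then have c3: "0 < c3" "c3 \<le> 1" using N1 by (auto simp: c3_def)
  have "c0 * c3 \<le> 1 * 1" using c0 c3 by (intro mult_mono) auto
  then have \<theta>: "0 < \<theta>" "\<theta> \<le> 1" using c0 c3 by (auto simp: \<theta>_def)
  have Q1: "1 \<le> real Q" by (simp add: Q_def)
  have \<sigma>: "0 < \<sigma>" "\<sigma> < 1" using \<theta> Q1 by (auto simp: \<sigma>_def)
  have bern: "1 \<le> (1 + \<theta>) * (1 - \<sigma>) ^ Q"
  proof -
    have "1 + real Q * (- \<sigma>) \<le> (1 + (- \<sigma>)) ^ Q" using \<sigma> by (intro Bernoulli_inequality) auto
    moreover have "real Q * \<sigma> = \<theta> / 2" using Q1 by (simp add: \<sigma>_def)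
    ultimately have "1 - \<theta> / 2 \<le> (1 - \<sigma>) ^ Q" by simp
    then have "(1 + \<theta>) * (1 - \<theta> / 2) \<le> (1 + \<theta>) * (1 - \<sigma>) ^ Q" using \<theta> by (intro mult_left_mono) auto
    moreover have "\<theta> * \<theta> \<le> 1 * \<theta>" using \<theta> by (intro mult_right_mono) auto
    then have "1 \<le> (1 + \<theta>) * (1 - \<theta> / 2)" by (simp add: algebra_simps)
    ultimately show ?thesis by linarith
  qed
  have K2: "2 * r < K * (2 * r)" "2 * r \<le> K * (2 * r)" using K r by auto
  have u2: "continuous_on {z. hdist z0 z \<le> 2 * r} u"
    using u(1) by (rule continuous_on_subset) (use K2 in auto)
  have upos: "0 \<le> u z" if "hdist z0 z \<le> 2 * r" for z using u(2) that K2 by auto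
  \<comment> \<open>The weight vanishes at distance 2r, which keeps a maximum point with a positive
    value inside the ball. At distance less than r it is at least r^Q.\<close>
  define g where "g z = u z * (2 * r - hdist z0 z) ^ Q" for z
  have "continuous_on {z. hdist z0 z \<le> 2 * r} g"
    unfolding g_def by (intro continuous_intros u2)
  moreover have "z0 \<in> {z. hdist z0 z \<le> 2 * r}" using r by simp
  ultimately obtain zm where zm: "hdist z0 zm \<le> 2 * r" "\<And>z. hdist z0 z \<le> 2 * r \<Longrightarrow> g z \<le> g zm"
    using continuous_attains_sup[OF compact_hcball, of z0 "2 * r" g] by blast
  define M D where "M = u zm" and "D = 2 * r - hdist z0 zm"
  have ga: "u za * r ^ Q \<le> M * D ^ Q"
  proof -
    have "u za * r ^ Q \<le> g za"
      unfolding g_def using z r upos[of za] by (intro mult_left_mono power_mono) auto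
    also have "\<dots> \<le> g zm" using z r by (intro zm) auto
    finally show ?thesis by (simp add: g_def M_def D_def)
  qed
  have M0: "0 \<le> M" and D0: "0 \<le> D" using upos zm(1) by (auto simp: M_def D_def)
  have ub: "0 \<le> u zb" using upos z r by simp
  show ?thesis
  proof (cases "M = 0 \<or> D = 0")
    case True
    then have "u za * r ^ Q \<le> 0" using ga by (auto simp: Q_def)
    then have "u za \<le> 0" using zero_less_power[OF r, of Q] by (simp add: mult_le_0_iff not_le[symmetric])
    moreover have "0 \<le> c0 * c3 / 8 * (\<theta> / (2 * (real N + 2)) / (2 * K)) ^ (N + 2)"
      using c0 c3 \<theta> K by simp
    ultimately have "c0 * c3 / 8 * (\<theta> / (2 * (real N + 2)) / (2 * K)) ^ (N + 2) * u za \<le> 0"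
      by (rule mult_nonneg_nonpos[rotated])
    then show ?thesis using ub by linarith
  next
    case False
    then have M: "0 < M" and D: "0 < D" using M0 D0 by auto
    \<comment> \<open>The ball of radius K \<rho> required by the growth lemma is then that of
      radius \<sigma> D about \<open>zm\<close>. On it the weight has dropped by a factor of at
      least (1 - \<sigma>)^Q, so u <= (1 + \<theta>) M.\<close>
    define \<rho> where "\<rho> = \<sigma> * D / K"
    have K\<rho>: "K * \<rho> = \<sigma> * D" using K by (simp add: \<rho>_def)
    have \<rho>: "0 < \<rho>" using \<sigma> D K by (simp add: \<rho>_def)
    have sD: "\<sigma> * D < D" using \<sigma> D by simp
    have "1 * \<rho> \<le> K * \<rho>" using K \<rho> by (intro mult_right_mono) auto
    then have \<rho>D: "\<rho> < D" using K\<rho> sD by linarith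
    have in2: "hdist z0 z < 2 * r" if "hdist zm z \<le> K * \<rho>" for z
      using hdist_triangle[of z0 z zm] that sD unfolding K\<rho> D_def by linarith
    have u_le: "u z \<le> (1 + \<theta>) * M" if "hdist zm z \<le> K * \<rho>" for z
    proof -
      have "hdist z0 z \<le> hdist z0 zm + \<sigma> * D"
        using hdist_triangle[of z0 z zm] that K\<rho> by simp
      then have "(1 - \<sigma>) * D \<le> 2 * r - hdist z0 z" by (simp add: D_def algebra_simps)
      then have "u z * ((1 - \<sigma>) * D) ^ Q \<le> g z"
        unfolding g_def using upos[OF less_imp_le[OF in2[OF that]]] \<sigma> D by (intro mult_left_mono power_mono) auto
      also have "\<dots> \<le> g zm" using in2[OF that] by (intro zm) simp
      also have "\<dots> = M * D ^ Q" by (simp add: g_def M_def D_def)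
      finally have "u z * (1 - \<sigma>) ^ Q * D ^ Q \<le> M * D ^ Q" by (simp add: power_mult_distrib mult.assoc)
      then have "u z * (1 - \<sigma>) ^ Q \<le> M" using D by simp
      then have "(1 + \<theta>) * (u z * (1 - \<sigma>) ^ Q) \<le> (1 + \<theta>) * M" using \<theta> by (intro mult_left_mono) auto
      moreover have "u z * 1 \<le> u z * ((1 + \<theta>) * (1 - \<sigma>) ^ Q)"
        using upos[OF less_imp_le[OF in2[OF that]]] bern by (intro mult_left_mono) auto
      ultimately show ?thesis by (simp add: mult.left_commute)
    qed
    \<comment> \<open>The mesh is so fine that a bound on \<open>u\<close> at a lattice point
      persists within distance h up to an error M/4. It depends on \<open>u\<close>, but cancels in
      the final bounds.\<close>
    obtain h0 where h0: "0 < h0" "\<And>\<zeta> z. hdist z0 \<zeta> \<le> 2 * r \<Longrightarrow> hdist \<zeta> z \<le> h0 \<Longrightarrow> \<bar>u \<zeta> - u z\<bar> < M / 4"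
      using uniformly_continuous_hdist[OF u(1) K2(1), of "M / 4"] M by auto
    define h where "h = min h0 (\<rho> / (2 * real N))"
    have h: "0 < h" "h \<le> h0" "h \<le> \<rho> / (2 * real N)" using h0(1) \<rho> N1 by (auto simp: h_def)
    have h2: "2 * real N * h \<le> \<rho>" using h(3) N1 by (simp add: field_simps)
    have "1 * h \<le> 2 * real N * h" using N1 h(1) by (intro mult_right_mono) auto
    then have h\<rho>: "h \<le> \<rho>" using h2 by simp
    obtain S where S: "finite S" "S \<subseteq> range (lattice_point h)" "\<And>\<zeta>. \<zeta> \<in> S \<Longrightarrow> hdist zm \<zeta> < \<rho>"
        and cS: "c3 * (\<rho> / h) ^ Q \<le> real (card S)"
      using lattice_count_lower[OF N h(1) h2, of zm] unfolding c3_def Q_def by metis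
    have S2r: "hdist z0 \<zeta> < 2 * r" if "\<zeta> \<in> S" for \<zeta>
      using hdist_triangle[of z0 \<zeta> zm] S(3)[OF that] \<rho>D unfolding D_def by linarith
    define S1 S2 where "S1 = {\<zeta>\<in>S. M / 2 \<le> u \<zeta>}" and "S2 = {\<zeta>\<in>S. u \<zeta> < M / 2}"
    have "S = S1 \<union> S2" "S1 \<inter> S2 = {}" "finite S1" "finite S2" using S(1) by (auto simp: S1_def S2_def)
    then have "card S = card S1 + card S2" by (simp add: card_Un_disjoint)
    \<comment> \<open>Either half of the lattice points near \<open>zm\<close> have u >= M/2, which
      spreads to \<open>zb\<close>, or half of them have u < M/2, which is contradictory.\<close>
    then consider "real (card S) / 2 \<le> card S1" | "real (card S) / 2 \<le> card S2" by linarith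
    then show ?thesis
    proof cases
      case 1
      have "M / 4 * c0 * card S1 * (h / (2 * r)) ^ (N + 2) \<le> u zb"
      proof (rule growth[OF h(1) _ A u])
        show "h \<le> 2 * r" using h\<rho> \<rho>D hdist_nonneg[of z0 zm] unfolding D_def by linarith
        show "S1 \<subseteq> range (lattice_point h)" using S(2) by (auto simp: S1_def)
        show "hdist z0 \<zeta> < 2 * r" if "\<zeta> \<in> S1" for \<zeta> using S2r that by (simp add: S1_def)
        show "0 < M / 4" using M by simp
        show "M / 4 \<le> u z" if "\<zeta> \<in> S1" "hdist \<zeta> z \<le> h" for \<zeta> z
        proof -
          have "\<bar>u \<zeta> - u z\<bar> < M / 4"
            using S2r[of \<zeta>] that h(2) by (intro h0(2)) (auto simp: S1_def)
          moreover have "M / 2 \<le> u \<zeta>" using that(1) by (simp add: S1_def)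
          ultimately show ?thesis by linarith
        qed
        show "hdist z0 zb < 2 * r" using z r by simp
      qed auto
      moreover have "M / 4 * c0 * (c3 * (\<rho> / h) ^ Q / 2) * (h / (2 * r)) ^ (N + 2) \<le> M / 4 * c0 * card S1 * (h / (2 * r)) ^ (N + 2)"
        using 1 cS M c0 h(1) r by (intro mult_right_mono mult_left_mono) auto
      \<comment> \<open>The powers of h cancel, and what remains is a constant times M (D/r)^Q,
        which dominates u(za) by the choice of \<open>zm\<close>.\<close>
      moreover have "M / 4 * c0 * (c3 * (\<rho> / h) ^ Q / 2) * (h / (2 * r)) ^ (N + 2)
          = c0 * c3 / 8 * (\<sigma> / (2 * K)) ^ Q * (M * D ^ Q / r ^ Q)"
      proof -
        have "(\<rho> / h) ^ Q * (h / (2 * r)) ^ Q = (\<rho> / h * (h / (2 * r))) ^ Q" by (rule power_mult_distrib[symmetric])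
        also have "\<rho> / h * (h / (2 * r)) = \<sigma> / (2 * K) * (D / r)" using h(1) by (simp add: \<rho>_def)
        finally have "(\<rho> / h) ^ Q * (h / (2 * r)) ^ Q = (\<sigma> / (2 * K)) ^ Q * (D ^ Q / r ^ Q)"
          by (simp add: power_mult_distrib power_divide)
        then have "M / 4 * c0 * c3 / 2 * ((\<rho> / h) ^ Q * (h / (2 * r)) ^ Q)
           = M / 4 * c0 * c3 / 2 * ((\<sigma> / (2 * K)) ^ Q * (D ^ Q / r ^ Q))" by simp
        then show ?thesis unfolding Q_def[symmetric] by (simp add: mult.assoc mult.left_commute mult.commute)
      qed
      moreover have "c0 * c3 / 8 * (\<sigma> / (2 * K)) ^ Q * u za \<le> c0 * c3 / 8 * (\<sigma> / (2 * K)) ^ Q * (M * D ^ Q / r ^ Q)"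
        using ga r c0 c3 \<sigma> K by (intro mult_left_mono) (auto simp: pos_le_divide_eq)
      moreover have "real Q = real N + 2" by (simp add: Q_def)
      ultimately show ?thesis unfolding \<sigma>_def Q_def[symmetric] by simp
    next
      case 2
      define w where "w z = (1 + \<theta>) * M - u z" for z
      have ball: "{z. hdist zm z \<le> K * \<rho>} \<subseteq> {z. hdist z0 z < 2 * r}" using in2 by auto
      \<comment> \<open>At a lattice point of \<open>S2\<close>, w exceeds M/2, hence M/4 within
        distance h of it. The growth lemma then gives a lower bound for w at the centre
        \<open>zm\<close>.\<close>
      have "M / 4 * c0 * card S2 * (h / \<rho>) ^ (N + 2) \<le> w zm"
      proof (rule growth[OF h(1) h\<rho>])
        show "nearly_constant l L {z. hdist zm z < K * \<rho>} A"
          using A by (rule nearly_constant_subset) (use in2 K2 in \<open>force dest: less_imp_le\<close>)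
        show "continuous_on {z. hdist zm z \<le> K * \<rho>} w"
          unfolding w_def using ball by (intro continuous_intros continuous_on_subset[OF u2]) auto
        show "0 \<le> w z" if "hdist zm z \<le> K * \<rho>" for z using u_le[OF that] by (simp add: w_def)
        show "solves A w z" if "hdist zm z < K * \<rho>" for z
          unfolding w_def using in2[of z] that K2 by (intro solves_const_diff u(3)) auto
        show "S2 \<subseteq> range (lattice_point h)" using S(2) by (auto simp: S2_def)
        show "hdist zm \<zeta> < \<rho>" if "\<zeta> \<in> S2" for \<zeta> using S(3) that by (simp add: S2_def)
        show "0 < M / 4" using M by simp
        show "M / 4 \<le> w z" if "\<zeta> \<in> S2" "hdist \<zeta> z \<le> h" for \<zeta> z
        proof -
          have "\<bar>u \<zeta> - u z\<bar> < M / 4"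
            using S2r[of \<zeta>] that h(2) by (intro h0(2)) (auto simp: S2_def)
          moreover have "u \<zeta> < M / 2" using that(1) by (simp add: S2_def)
          moreover have "0 \<le> \<theta> * M" using \<theta> M by simp
          ultimately show ?thesis unfolding w_def distrib_right by linarith
        qed
        show "hdist zm zm < \<rho>" using \<rho> by simp
      qed
      moreover have "M / 4 * c0 * (c3 * (\<rho> / h) ^ Q / 2) * (h / \<rho>) ^ (N + 2) \<le> M / 4 * c0 * card S2 * (h / \<rho>) ^ (N + 2)"
        using 2 cS M c0 h(1) \<rho> by (intro mult_right_mono mult_left_mono) auto
      \<comment> \<open>By the choice of \<theta> this is twice w(zm) = \<theta> M, a
        contradiction.\<close>
      moreover have "M / 4 * c0 * (c3 * (\<rho> / h) ^ Q / 2) * (h / \<rho>) ^ (N + 2) = 2 * (\<theta> * M)"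
      proof -
        have "(\<rho> / h) ^ Q * (h / \<rho>) ^ Q = 1"
          using h(1) \<rho> by (simp flip: power_mult_distrib)
        then have "M / 4 * c0 * c3 / 2 * ((\<rho> / h) ^ Q * (h / \<rho>) ^ Q) = 2 * (\<theta> * M)" by (simp add: \<theta>_def)
        then show ?thesis unfolding Q_def[symmetric] by (simp add: mult.assoc mult.left_commute mult.commute)
      qed
      moreover have "w zm = \<theta> * M" by (simp add: w_def M_def distrib_right)
      moreover have "0 < \<theta> * M" using \<theta> M by simp
      ultimately show ?thesis by linarith
    qed
  qed
qed

lemma C2_on_imp_continuous_on:
  assumes "C2_on S u"
  shows "continuous_on S u"
  using assms unfolding C2_on_def
  by (intro continuous_at_imp_continuous_on ballI differentiable_imp_continuous_within) auto

theorem theorem5p1: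
  fixes l L :: real
  assumes "0 < l" and "l \<le> 1" and "1 \<le> L"
  shows "\<exists>C K. C \<ge> 1 \<and> K \<ge> 2 * sqrt (L / l) + 1 \<and>
    (\<forall>\<omega> :: real \<Rightarrow> real. modulus \<omega> \<longrightarrow> (\<exists>\<epsilon>0 > 0.
    (\<forall>(\<Omega> :: 'n::finite hpt set) A u z0 r.
       open \<Omega> \<and> symplectic_on \<Omega> A \<and> Mclass l L \<Omega> A \<and> Cclass \<Omega> \<omega> A \<and>
       C2_on \<Omega> u \<and> z0 \<in> \<Omega> \<and> 0 < r \<and> r \<le> (2 * sqrt (L / l) + 1) / K * \<epsilon>0 \<and>
       hball z0 (K * r) \<subseteq> \<Omega> \<and>
       (\<forall>z\<in>hball z0 (K * r). u z \<ge> 0 \<and> LA A u z = 0)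
       \<longrightarrow> (SUP z\<in>hball z0 r. u z) \<le> C * (INF z\<in>hball z0 r. u z))))"
proof -
  note l = assms
  define N where "N = CARD('n + 'n)"
  define c1 c2 where "c1 = L powr (- ((real N + 1) / 2))" and "c2 = l powr (- ((real N + 1) / 2))"
  define K1 where "K1 = 1 + 4 * c2 / c1"
  define c0 where "c0 = min (1 / 3 ^ (N + 1)) (c1 / (c2 * 3 ^ (N + 1) * 2 ^ (2 * N + 5) * (K1 + 1)))"
  define \<eta> where "\<eta> = 2 * sqrt (L / l) + 1"
  define c3 where "c3 = (1 / (2 * real N)) ^ N / 2"
  define k where "k = c0 * c3 / 8 * (c0 * c3 / 16 / (2 * (real N + 2)) / (2 * K1)) ^ (N + 2)"
  \<comment> \<open>The argument takes place in the closed ball of radius 2 \<open>K1\<close> r; the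
    extra 1 puts it inside the open ball of radius K r.\<close>
  define K C where "K = max (2 * K1 + 1) \<eta>" and "C = max 1 (1 / k)"
  have c1: "0 < c1" "c1 \<le> 1" and c2: "1 \<le> c2"
    using l ge_one_powr_ge_zero[of L "(real N + 1) / 2"] powr_le1[of "(real N + 1) / 2" l]
    by (auto simp: c1_def c2_def powr_minus_divide)
  have "1 \<le> c2 / c1" using c1 c2 by simp
  then have K1: "5 \<le> K1" by (simp add: K1_def)
  have "(1::real) \<le> 3 ^ (N + 1)" by (rule one_le_power) simp
  then have "1 / 3 ^ (N + 1) \<le> (1::real)" by simp
  moreover have "c0 \<le> 1 / 3 ^ (N + 1)" unfolding c0_def by (rule min.cobounded1)
  moreover have "0 < c1 / (c2 * 3 ^ (N + 1) * 2 ^ (2 * N + 5) * (K1 + 1))" using c1 c2 K1 by simp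
  then have "0 < c0" by (simp add: c0_def)
  ultimately have c0: "0 < c0" "c0 \<le> 1" by linarith+
  have N1: "1 \<le> real N" using zero_less_card_finite[where 'a = "'n + 'n"] unfolding N_def[symmetric] by simp
  have c3: "0 < c3" using N1 by (simp add: c3_def)
  have k: "0 < k" using c0 c3 K1 by (simp add: k_def)
  have \<eta>: "1 \<le> \<eta>" using l by (simp add: \<eta>_def)
  have K: "2 * K1 + 1 \<le> K" "\<eta> \<le> K" by (auto simp: K_def)
  show ?thesis
  proof (rule exI[of _ C], rule exI[of _ K], intro conjI allI impI)
    show "1 \<le> C" by (simp add: C_def)
    show "2 * sqrt (L / l) + 1 \<le> K" using K by (simp add: \<eta>_def)
  next
    fix \<omega> :: "real \<Rightarrow> real" assume \<omega>: "modulus \<omega>"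
    \<comment> \<open>The largest value that \<open>nearly_constant\<close> admits.\<close>
    define \<kappa> where "\<kappa> = 1 / (2 * real N + 9)"
    have \<kappa>: "0 < \<kappa>" by (simp add: \<kappa>_def add_nonneg_pos)
    have "\<forall>\<^sub>F s in at_right 0. \<omega> s < \<kappa> * l"
    proof (rule order_tendstoD(2))
      show "(\<omega> \<longlongrightarrow> 0) (at_right 0)" using \<omega> by (simp add: modulus_def)
      show "0 < \<kappa> * l" using \<kappa> l by simp
    qed
    moreover have "\<forall>\<^sub>F s in at_right (0::real). s \<in> {0<..<1}" by (rule eventually_at_right_real) simp
    ultimately have "\<forall>\<^sub>F s in at_right 0. 0 < s \<and> s < 1 \<and> \<omega> s \<le> \<kappa> * l"
      by eventually_elim auto
    then obtain e where e: "0 < e" "e < 1" "\<omega> e \<le> \<kappa> * l"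
      using eventually_happens'[OF trivial_limit_at_right_real] by blast
    \<comment> \<open>With this choice the radius condition reads 4 \<open>K1\<close> r <= e. Two
      points of the ball of radius 2 \<open>K1\<close> r are then less than e apart, so the
      coefficients differ by at most \<kappa> l in operator norm.\<close>
    define \<epsilon>0 where "\<epsilon>0 = e * K / (4 * K1 * \<eta>)"
    have "0 < \<epsilon>0" using e K K1 \<eta> by (simp add: \<epsilon>0_def)
    moreover have "(SUP z\<in>hball z0 r. u z) \<le> C * (INF z\<in>hball z0 r. u z)"
      if *: "open \<Omega>" "symplectic_on \<Omega> A" "Mclass l L \<Omega> A" "Cclass \<Omega> \<omega> A" "C2_on \<Omega> u" "0 < r"
        "r \<le> (2 * sqrt (L / l) + 1) / K * \<epsilon>0" "hball z0 (K * r) \<subseteq> \<Omega>"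
        "\<forall>z\<in>hball z0 (K * r). u z \<ge> 0 \<and> LA A u z = 0"
      for \<Omega> :: "'n hpt set" and A u z0 r
    proof -
      have "r \<le> \<eta> / K * \<epsilon>0" using *(7) by (simp add: \<eta>_def)
      also have "\<dots> = e / (4 * K1)" using \<eta> K K1 by (simp add: \<epsilon>0_def)
      finally have re: "4 * K1 * r \<le> e" using K1 by (simp add: field_simps)
      have "2 * K1 * r < K * r" using K \<open>0 < r\<close> by simp
      then have sub: "hdist z0 z \<le> K1 * (2 * r) \<Longrightarrow> z \<in> hball z0 (K * r)" for z
        by (simp add: hball_def)
      then have sub': "hdist z0 z \<le> K1 * (2 * r) \<Longrightarrow> z \<in> \<Omega>" for z using *(8) by blast
      have near: "hdist \<zeta> z < e" if "hdist z0 \<zeta> < K1 * (2 * r)" "hdist z0 z < K1 * (2 * r)" for \<zeta> z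
        using hdist_triangle[of \<zeta> z z0] that re by (simp add: hdist_commute)
      have A: "nearly_constant l L {z. hdist z0 z < K1 * (2 * r)} A"
        unfolding nearly_constant_def
      proof (intro conjI ballI exI[of _ \<kappa>] allI)
        fix \<zeta> assume "\<zeta> \<in> {z. hdist z0 z < K1 * (2 * r)}"
        then have \<zeta>: "hdist z0 \<zeta> < K1 * (2 * r)" "\<zeta> \<in> \<Omega>" using sub' by auto
        show "gauge_pair (A \<zeta>) (matrix_inv (A \<zeta>))" by (rule symplectic_gauge_pair[OF *(2,3) \<zeta>(2)])
        show "l * (x \<bullet> x) \<le> x \<bullet> (A \<zeta> *v x)" "x \<bullet> (A \<zeta> *v x) \<le> L * (x \<bullet> x)" for x
          using *(3) \<zeta>(2) by (auto simp: Mclass_def)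
        fix z x assume "z \<in> {z. hdist z0 z < K1 * (2 * r)}"
        then have z: "hdist z0 z < K1 * (2 * r)" "z \<in> \<Omega>" using sub' by auto
        show "(1 - \<kappa>) * (x \<bullet> (A \<zeta> *v x)) \<le> x \<bullet> (A z *v x)" "x \<bullet> (A z *v x) \<le> (1 + \<kappa>) * (x \<bullet> (A \<zeta> *v x))"
          by (rule Cclass_form_bounds[OF *(4,3) l(1) \<zeta>(2) z(2) near[OF \<zeta>(1) z(1)] e])+
      qed (simp add: \<kappa>_def N_def)
      have Harnack: "u za \<le> C * u zb" if z: "za \<in> hball z0 r" "zb \<in> hball z0 r" for za zb
      proof -
        have "k * u za \<le> u zb"
          unfolding k_def c3_def
        proof (rule harnack_of_growth[OF N_def _ c0 K1 A \<open>0 < r\<close>])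
          fix w z1 \<rho> h H T z
          assume "0 < h" "h \<le> \<rho>" "nearly_constant l L {z. hdist z1 z < K1 * \<rho>} A"
            "continuous_on {z. hdist z1 z \<le> K1 * \<rho>} w" "\<And>z. hdist z1 z \<le> K1 * \<rho> \<Longrightarrow> 0 \<le> w z"
            "\<And>z. hdist z1 z < K1 * \<rho> \<Longrightarrow> solves A w z" "H \<subseteq> range (lattice_point h)"
            "\<And>\<zeta>. \<zeta> \<in> H \<Longrightarrow> hdist z1 \<zeta> < \<rho>" "0 < T"
            "\<And>\<zeta> z. \<zeta> \<in> H \<Longrightarrow> hdist \<zeta> z \<le> h \<Longrightarrow> T \<le> w z" "hdist z1 z < \<rho>"
          from growth_estimate[where 'n = 'n, OF l, folded N_def, folded c1_def c2_def, OF K1_def this]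
          show "T * c0 * card H * (h / \<rho>) ^ (N + 2) \<le> w z" unfolding c0_def .
        next
          show "continuous_on {z. hdist z0 z \<le> K1 * (2 * r)} u"
            using C2_on_imp_continuous_on[OF *(5)] by (rule continuous_on_subset) (auto intro: sub')
          show "0 \<le> u z" if "hdist z0 z \<le> K1 * (2 * r)" for z using *(9) sub[OF that] by blast
          show "solves A u z" if "hdist z0 z < K1 * (2 * r)" for z
            using *(9) sub[OF less_imp_le[OF that]] sub'[OF less_imp_le[OF that]]
            by (intro solves_C2[OF *(1,5)]) auto
          show "hdist z0 za < r" "hdist z0 zb < r" using z by (auto simp: hball_def)
        qed
        then have "u za \<le> 1 / k * u zb" using k by (simp add: field_simps)
        also have "\<dots> \<le> C * u zb"
        proof (rule mult_right_mono)
          have "hdist z0 zb \<le> K1 * (2 * r)"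
          proof -
            have "1 * (2 * r) \<le> K1 * (2 * r)" using K1 \<open>0 < r\<close> by (intro mult_right_mono) auto
            moreover have "hdist z0 zb < r" using z(2) by (simp add: hball_def)
            ultimately show ?thesis using \<open>0 < r\<close> by linarith
          qed
          then show "0 \<le> u zb" using *(9) sub by blast
        qed (simp add: C_def)
        finally show ?thesis .
      qed
      have "z0 \<in> hball z0 r" using \<open>0 < r\<close> by (simp add: hball_def)
      then have ne: "hball z0 r \<noteq> {}" by blast
      have C: "0 < C" by (simp add: C_def less_max_iff_disj)
      \<comment> \<open>Dividing by C > 0 lets the pointwise inequality be used twice: for a fixed
        \<open>zb\<close> it bounds the supremum, and the result is a lower bound for every
        u(zb).\<close>
      have "(SUP z\<in>hball z0 r. u z) / C \<le> (INF z\<in>hball z0 r. u z)"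
      proof (rule cINF_greatest[OF ne])
        fix zb assume "zb \<in> hball z0 r"
        then have "(SUP z\<in>hball z0 r. u z) \<le> C * u zb" by (intro cSUP_least[OF ne] Harnack)
        then show "(SUP z\<in>hball z0 r. u z) / C \<le> u zb" using C by (simp add: pos_divide_le_eq mult.commute)
      qed
      then show ?thesis using C by (simp add: pos_divide_le_eq mult.commute)
    qed
    ultimately show "\<exists>\<epsilon>0>0. \<forall>(\<Omega> :: 'n hpt set) A u z0 r.
       open \<Omega> \<and> symplectic_on \<Omega> A \<and> Mclass l L \<Omega> A \<and> Cclass \<Omega> \<omega> A \<and>
       C2_on \<Omega> u \<and> z0 \<in> \<Omega> \<and> 0 < r \<and> r \<le> (2 * sqrt (L / l) + 1) / K * \<epsilon>0 \<and>
       hball z0 (K * r) \<subseteq> \<Omega> \<and>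
       (\<forall>z\<in>hball z0 (K * r). u z \<ge> 0 \<and> LA A u z = 0)
       \<longrightarrow> (SUP z\<in>hball z0 r. u z) \<le> C * (INF z\<in>hball z0 r. u z)"
      by (intro exI[of _ \<epsilon>0]) blast
  qed
qed

end
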